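(* Let $\mu\in\mathbb{R}\setminus[0,4]$ and let $h:\mathbb{R}\to\mathbb{R}$ be even, smooth and exponentially decaying. For each irrational $\theta\in(0,1)$ there is a set $\Sigma\subset\mathbb{R}$ such that $$\mathbb{P}\left(\{b\in[0,1-\theta):\sigma(H_r(b))=\Sigma\}\right)=1,$$ where $\mathbb{P}$ is normalized Lebesgue measure on $[0,1-\theta)$ and $H_r(b)$ is the reduced incommensurate coupled chain operator on $\ell^2(\mathbb{Z})$.
   Context: The discrete Laplacian is $(\Delta\psi)_n := \psi_{n+1}-2\psi_n+\psi_{n-1}$ on $\ell^2(\mathbb{Z})$; the spectrum of $-\Delta$ is $[0,4]$, and $(-\Delta-\mu)^{-1}_{nn'}$ are the matrix elements of the inverse of $-\Delta-\mu$. Exponentially decaying means $|h(\eta)|\le Ce^{-c|\eta|}$ for some $C,c>0$. For $b\in\mathbb{R}$, the reduced incommensurate coupled chain operator is the self-adjoint operator on $\ell^2(\mathbb{Z})$ $$(H_r(b)\psi)_n := -(\Delta\psi)_n - \sum_{n'\in\mathbb{Z}} h(n-(1-\theta)n'-b)\sum_{n''\in\mathbb{Z}}(-\Delta-\mu)^{-1}_{n'n''}\sum_{n'''\in\mathbb{Z}} h((1-\theta)n''+b-n''')\psi_{n'''}.$$ $\sigma(\cdot)$ denotes the spectrum. *)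

theory Defs
  imports "HOL-Analysis.Analysis"
begin

definition ell2 :: "(int \<Rightarrow> complex) set" where
  "ell2 = {\<psi>. (\<lambda>n. (cmod (\<psi> n))\<^sup>2) summable_on UNIV}"

definition ell2_norm :: "(int \<Rightarrow> complex) \<Rightarrow> real" where
  "ell2_norm \<psi> = sqrt (\<Sum>\<^sub>\<infinity>n. (cmod (\<psi> n))\<^sup>2)"

text \<open>Operators are maps on all sequences; everything below only inspects their action on
  \<^const>\<open>ell2\<close>.\<close>

type_synonym seq_op = "(int \<Rightarrow> complex) \<Rightarrow> (int \<Rightarrow> complex)"

definition minus_scalar :: "seq_op \<Rightarrow> complex \<Rightarrow> seq_op" where
  "minus_scalar A z = (\<lambda>\<psi> n. A \<psi> n - z * \<psi> n)"

text \<open>The inverse of \<open>A - z\<close>, meaningful when \<open>A - z\<close> is a bijection of \<^const>\<open>ell2\<close>.\<close>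

definition resolvent :: "seq_op \<Rightarrow> complex \<Rightarrow> seq_op" where
  "resolvent A z = inv_into ell2 (minus_scalar A z)"

text \<open>For a linear \<open>A\<close> the inverse of \<open>A - z\<close> is automatically linear, so only its
  boundedness is demanded.\<close>

definition resolvent_set :: "seq_op \<Rightarrow> complex set" where
  "resolvent_set A = {z. bij_betw (minus_scalar A z) ell2 ell2 \<and>
     (\<exists>C. \<forall>\<psi>\<in>ell2. ell2_norm (resolvent A z \<psi>) \<le> C * ell2_norm \<psi>)}"

definition spectrum :: "seq_op \<Rightarrow> complex set" where
  "spectrum A = - resolvent_set A"

definition matrix_element :: "seq_op \<Rightarrow> int \<Rightarrow> int \<Rightarrow> complex" where
  "matrix_element A n m = A (\<lambda>k. if k = m then 1 else 0) n"

definition laplacian :: seq_op where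
  "laplacian \<psi> n = \<psi> (n + 1) - 2 * \<psi> n + \<psi> (n - 1)"

definition green :: "real \<Rightarrow> int \<Rightarrow> int \<Rightarrow> complex" where
  "green \<mu> = matrix_element (resolvent (\<lambda>\<psi> n. - laplacian \<psi> n) (complex_of_real \<mu>))"

definition reduced_chain_op :: "real \<Rightarrow> (real \<Rightarrow> real) \<Rightarrow> real \<Rightarrow> real \<Rightarrow> seq_op" where
  "reduced_chain_op \<mu> h \<theta> b \<psi> n =
     - laplacian \<psi> n
     - (\<Sum>\<^sub>\<infinity>n'. complex_of_real (h (of_int n - (1 - \<theta>) * of_int n' - b)) *
         (\<Sum>\<^sub>\<infinity>n''. green \<mu> n' n'' *
           (\<Sum>\<^sub>\<infinity>n'''. complex_of_real (h ((1 - \<theta>) * of_int n'' + b - of_int n''')) * \<psi> n''')))"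

definition smooth :: "(real \<Rightarrow> real) \<Rightarrow> bool" where
  "smooth f \<longleftrightarrow> (\<forall>k. (deriv ^^ k) f differentiable_on UNIV)"

definition exponentially_decaying :: "(real \<Rightarrow> real) \<Rightarrow> bool" where
  "exponentially_decaying f \<longleftrightarrow>
     (\<exists>C>0. \<exists>c>0. \<forall>\<eta>. \<bar>f \<eta>\<bar> \<le> C * exp (- c * \<bar>\<eta>\<bar>))"

end

theory Submission
  imports Defs
begin

text \<open>
  For fixed \<open>z\<close> let \<open>U\<close> be the set of all \<open>b\<close> such that \<open>z\<close> is in the resolvent set of \<open>H(b)\<close>.
  By the Schur test \<open>b \<mapsto> H(b)\<close> is continuous in operator norm, so \<open>U\<close> is open. Reindexing the inner
  lattice gives \<open>H(b + (1 - \<theta>)) = H(b)\<close>, and the unit shift conjugates \<open>H(b)\<close> to \<open>H(b + 1)\<close>, so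
  \<open>U\<close> is invariant under the group generated by \<open>1\<close> and \<open>1 - \<theta>\<close>. This group is dense, hence
  \<open>U\<close> is empty or everything: the spectrum is the same for every \<open>b\<close>, not only for almost every
  one. It is real because \<open>H(b)\<close> is symmetric.
\<close>

section \<open>The Hilbert space of square-summable sequences\<close>

text \<open>Openness in operator norm needs a Banach space of operators, while
  \<open>spectrum\<close> speaks of maps on raw sequences. Square-summable sequences therefore
  become a type \<open>l2\<close>, the operators live in \<open>l2 \<Rightarrow>\<^sub>L l2\<close>,
  and \<open>mem_resolvent_set_iff\<close> translates back. As a vector space \<open>l2\<close> is
  only real: complex scalars act through \<open>cmul\<close>, and self-adjointness is expressed as
  symmetry for a real inner product together with commutation with multiplication by \<i>. The Green
  function is given only as an inverse. Its reality, symmetry, translation invariance and summable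
  rows are all read off the closed form \<open>g * l ^ nat \<bar>n - m\<bar>\<close>, where \<mu>
  outside [0,4] supplies a root with |l| < 1. Norm continuity in b is more than continuity of each
  matrix entry: the differences must be small in sum along all rows and columns at once. This is why
  part of the exponential decay of h is traded for smallness.\<close>

lemma ell2_iff: "\<psi> \<in> ell2 \<longleftrightarrow> (\<lambda>n. (cmod (\<psi> n))\<^sup>2) summable_on UNIV"
  by (simp add: ell2_def)

lemma ell2_boundI:
  assumes "\<And>F. finite F \<Longrightarrow> (\<Sum>n\<in>F. (cmod (\<psi> n))\<^sup>2) \<le> B"
  shows "\<psi> \<in> ell2" "(\<Sum>\<^sub>\<infinity>n. (cmod (\<psi> n))\<^sup>2) \<le> B"
proof -
  show *: "\<psi> \<in> ell2"
    unfolding ell2_iff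
    by (rule nonneg_bdd_above_summable_on) (auto intro!: bdd_aboveI[where M = B] assms)
  show "(\<Sum>\<^sub>\<infinity>n. (cmod (\<psi> n))\<^sup>2) \<le> B"
    using * by (intro infsum_le_finite_sums) (auto simp: ell2_iff intro: assms)
qed

lemma ell2_add:
  assumes "\<phi> \<in> ell2" "\<psi> \<in> ell2"
  shows "(\<lambda>n. \<phi> n + \<psi> n) \<in> ell2"
proof -
  have le: "(cmod (a + b))\<^sup>2 \<le> 2 * (cmod a)\<^sup>2 + 2 * (cmod b)\<^sup>2" for a b :: complex
  proof -
    have "(cmod (a + b))\<^sup>2 \<le> (cmod a + cmod b)\<^sup>2"
      by (simp add: norm_triangle_ineq power_mono)
    also have "\<dots> \<le> 2 * (cmod a)\<^sup>2 + 2 * (cmod b)\<^sup>2"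
      using sum_squares_bound[of "cmod a" "cmod b"] by (simp add: power2_sum)
    finally show ?thesis .
  qed
  show ?thesis
    unfolding ell2_iff
    by (rule summable_on_comparison_test
          [where f = "\<lambda>n. 2 * (cmod (\<phi> n))\<^sup>2 + 2 * (cmod (\<psi> n))\<^sup>2"])
       (use assms le in \<open>auto simp: ell2_iff intro!: summable_on_add summable_on_cmult_right\<close>)
qed

lemma ell2_scale: "\<psi> \<in> ell2 \<Longrightarrow> (\<lambda>n. c * \<psi> n) \<in> ell2"
  by (auto simp: ell2_iff norm_mult power_mult_distrib intro!: summable_on_cmult_right)

lemma ell2_zero: "(\<lambda>n. 0) \<in> ell2"
  by (simp add: ell2_iff)

typedef l2 = ell2
  morphisms seq_of l2_of
  using ell2_zero by blast

setup_lifting type_definition_l2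

lemma l2_eqI: "(\<And>n. seq_of x n = seq_of y n) \<Longrightarrow> x = y"
  by (metis ext seq_of_inject)

lemma seq_of_summable: "(\<lambda>n. (cmod (seq_of x n))\<^sup>2) summable_on UNIV"
  using seq_of[of x] by (simp add: ell2_iff)

lemma abs_inner_le_sum_squares:
  fixes a b :: "'a::real_inner"
  shows "\<bar>a \<bullet> b\<bar> \<le> (norm a)\<^sup>2 + (norm b)\<^sup>2"
  using Cauchy_Schwarz_ineq2[of a b] sum_squares_bound[of "norm a" "norm b"]
    mult_nonneg_nonneg[OF norm_ge_zero[of a] norm_ge_zero[of b]]
  by linarith

lemma seq_of_inner_summable: "(\<lambda>n. seq_of x n \<bullet> seq_of y n) summable_on UNIV"
proof -
  have "(\<lambda>n. norm (seq_of x n \<bullet> seq_of y n)) summable_on UNIV"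
  proof (rule summable_on_comparison_test)
    show "(\<lambda>n. (cmod (seq_of x n))\<^sup>2 + (cmod (seq_of y n))\<^sup>2) summable_on UNIV"
      by (intro summable_on_add seq_of_summable)
    show "norm (seq_of x n \<bullet> seq_of y n) \<le> (cmod (seq_of x n))\<^sup>2 + (cmod (seq_of y n))\<^sup>2" for n
      using abs_inner_le_sum_squares[of "seq_of x n" "seq_of y n"] by simp
  qed auto
  thus ?thesis by (rule abs_summable_summable)
qed

text \<open>On complex numbers \<open>inner\<close> is the real part of the Hermitian product, so
  the sum below is the real part of the usual scalar product. It induces the usual norm, and for
  operators commuting with \<open>cmul \<i>\<close> symmetry with respect to it is the same as
  Hermitian symmetry.\<close>

instantiation l2 :: real_inner
begin

lift_definition zero_l2 :: l2 is "\<lambda>n. 0" by (rule ell2_zero)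
lift_definition plus_l2 :: "l2 \<Rightarrow> l2 \<Rightarrow> l2" is "\<lambda>\<phi> \<psi> n. \<phi> n + \<psi> n" by (rule ell2_add)
lift_definition scaleR_l2 :: "real \<Rightarrow> l2 \<Rightarrow> l2" is "\<lambda>r \<psi> n. complex_of_real r * \<psi> n"
  by (rule ell2_scale)
definition uminus_l2 :: "l2 \<Rightarrow> l2" where "- x = scaleR (-1) (x :: l2)"
definition minus_l2 :: "l2 \<Rightarrow> l2 \<Rightarrow> l2" where "x - y = x + - (y :: l2)"
definition inner_l2 :: "l2 \<Rightarrow> l2 \<Rightarrow> real" where
  "x \<bullet> y = (\<Sum>\<^sub>\<infinity>n. seq_of x n \<bullet> seq_of y n)"
definition norm_l2 :: "l2 \<Rightarrow> real" where "norm (x :: l2) = sqrt (x \<bullet> x)"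
definition sgn_l2 :: "l2 \<Rightarrow> l2" where "sgn (x :: l2) = scaleR (inverse (norm x)) x"
definition dist_l2 :: "l2 \<Rightarrow> l2 \<Rightarrow> real" where "dist x y = norm (x - y :: l2)"
definition uniformity_l2 :: "(l2 \<times> l2) filter" where
  "uniformity_l2 = (INF e\<in>{0 <..}. principal {(x, y). dist x y < e})"
definition open_l2 :: "l2 set \<Rightarrow> bool" where
  "open_l2 S \<longleftrightarrow> (\<forall>x\<in>S. \<forall>\<^sub>F (x', y) in uniformity. x' = x \<longrightarrow> y \<in> S)"

instance
proof
  fix x y z :: l2 and a b r :: real
  show "x + y + z = x + (y + z)" "x + y = y + x" "0 + x = x"
    by (rule l2_eqI; simp add: plus_l2.rep_eq zero_l2.rep_eq)+
  show "- x + x = 0" "x - y = x + - y"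
    "a *\<^sub>R (x + y) = a *\<^sub>R x + a *\<^sub>R y" "(a + b) *\<^sub>R x = a *\<^sub>R x + b *\<^sub>R x"
    "a *\<^sub>R b *\<^sub>R x = (a * b) *\<^sub>R x" "1 *\<^sub>R x = x"
    by (rule l2_eqI; simp add: plus_l2.rep_eq zero_l2.rep_eq uminus_l2_def minus_l2_def
          scaleR_l2.rep_eq algebra_simps)+
  show "sgn x = scaleR (inverse (norm x)) x" "dist x y = norm (x - y)" "norm x = sqrt (x \<bullet> x)"
    by (rule sgn_l2_def dist_l2_def norm_l2_def)+
  show "(uniformity :: (l2 \<times> l2) filter) = (INF e\<in>{0 <..}. principal {(x, y). dist x y < e})"
    by (rule uniformity_l2_def)
  show "open U \<longleftrightarrow> (\<forall>x\<in>U. \<forall>\<^sub>F (x', y) in uniformity. x' = x \<longrightarrow> y \<in> U)" for U :: "l2 set"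
    by (rule open_l2_def)
  show "x \<bullet> y = y \<bullet> x" by (simp add: inner_l2_def inner_commute)
  show "(x + y) \<bullet> z = x \<bullet> z + y \<bullet> z"
    by (simp add: inner_l2_def plus_l2.rep_eq inner_add_left infsum_add seq_of_inner_summable)
  show "(r *\<^sub>R x) \<bullet> y = r * (x \<bullet> y)"
    by (simp add: inner_l2_def scaleR_l2.rep_eq infsum_cmult_right'
        flip: scaleR_conv_of_real)
  show "0 \<le> x \<bullet> x" by (simp add: inner_l2_def infsum_nonneg)
  show "x \<bullet> x = 0 \<longleftrightarrow> x = 0"
  proof
    assume "x \<bullet> x = 0"
    have "seq_of x n = 0" for n
    proof -
      have "seq_of x n \<bullet> seq_of x n = 0"
        by (rule nonneg_infsum_le_0D[where A = UNIV])
           (use \<open>x \<bullet> x = 0\<close> in \<open>auto simp: inner_l2_def seq_of_inner_summable\<close>)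
      thus ?thesis by simp
    qed
    thus "x = 0" by (intro l2_eqI) (simp add: zero_l2.rep_eq)
  qed (simp add: inner_l2_def zero_l2.rep_eq)
qed

end

lemma seq_of_simps [simp]:
  "seq_of 0 n = 0" "seq_of (x + y) n = seq_of x n + seq_of y n"
  "seq_of (r *\<^sub>R x) n = of_real r * seq_of x n"
  "seq_of (- x) n = - seq_of x n" "seq_of (x - y) n = seq_of x n - seq_of y n"
  unfolding minus_l2_def uminus_l2_def
  by (simp_all only: zero_l2.rep_eq plus_l2.rep_eq scaleR_l2.rep_eq) simp_all

lemma norm_l2_eq: "norm x = ell2_norm (seq_of x)"
  unfolding norm_l2_def inner_l2_def ell2_norm_def power2_norm_eq_inner ..

lemma norm_l2_sq: "(norm x)\<^sup>2 = (\<Sum>\<^sub>\<infinity>n. (cmod (seq_of x n))\<^sup>2)"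
  unfolding norm_l2_eq ell2_norm_def by (simp add: infsum_nonneg)

lemma sum_le_norm_l2_sq:
  "finite F \<Longrightarrow> (\<Sum>n\<in>F. (cmod (seq_of x n))\<^sup>2) \<le> (norm x)\<^sup>2"
  unfolding norm_l2_sq by (rule finite_sum_le_infsum[OF seq_of_summable]) auto

lemma cmod_seq_of_le: "cmod (seq_of x n) \<le> norm x"
proof (rule power2_le_imp_le)
  show "(cmod (seq_of x n))\<^sup>2 \<le> (norm x)\<^sup>2"
    using sum_le_norm_l2_sq[of "{n}" x] by (simp only: sum.insert finite.intros empty_iff not_False_eq_True sum.empty add_0_right)
qed (rule norm_ge_zero)

lemma norm_l2_leI:
  assumes "0 \<le> B" "\<And>F. finite F \<Longrightarrow> (\<Sum>n\<in>F. (cmod (seq_of x n))\<^sup>2) \<le> B\<^sup>2"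
  shows "norm x \<le> B"
proof (rule power2_le_imp_le[OF _ assms(1)])
  show "(norm x)\<^sup>2 \<le> B\<^sup>2"
    unfolding norm_l2_sq by (rule ell2_boundI(2)) (rule assms(2))
qed

text \<open>Coordinates are bounded by the norm, so a Cauchy sequence converges coordinatewise. On a
  finite set of coordinates the Cauchy estimate passes to the limit, and an estimate uniform in the
  finite set is an estimate of the norm.\<close>

instance l2 :: complete_space
proof
  fix X :: "nat \<Rightarrow> l2"
  assume X: "Cauchy X"
  have "Cauchy (\<lambda>k. seq_of (X k) n)" for n
  proof (rule metric_CauchyI)
    fix e :: real assume "e > 0"
    then obtain M where "\<forall>i\<ge>M. \<forall>j\<ge>M. dist (X i) (X j) < e"
      using X by (auto simp: Cauchy_def)
    thus "\<exists>M. \<forall>i\<ge>M. \<forall>j\<ge>M. dist (seq_of (X i) n) (seq_of (X j) n) < e"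
      using cmod_seq_of_le[of "X _ - X _" n] unfolding dist_norm
      by (metis le_less_trans seq_of_simps(5))
  qed
  hence "\<forall>n. \<exists>l. (\<lambda>k. seq_of (X k) n) \<longlonglongrightarrow> l"
    using Cauchy_convergent convergent_def by blast
  then obtain y where y: "\<And>n. (\<lambda>k. seq_of (X k) n) \<longlonglongrightarrow> y n" by metis
  have tail: "(\<Sum>n\<in>F. (cmod (seq_of (X i) n - y n))\<^sup>2) \<le> e\<^sup>2"
    if M: "\<forall>i\<ge>M. \<forall>j\<ge>M. dist (X i) (X j) < e" and "i \<ge> M" "finite F" for M e i F
  proof (rule tendsto_upperbound)
    show "(\<lambda>j. \<Sum>n\<in>F. (cmod (seq_of (X i) n - seq_of (X j) n))\<^sup>2) \<longlonglongrightarrow>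
            (\<Sum>n\<in>F. (cmod (seq_of (X i) n - y n))\<^sup>2)"
      by (intro tendsto_intros y)
    show "\<forall>\<^sub>F j in sequentially. (\<Sum>n\<in>F. (cmod (seq_of (X i) n - seq_of (X j) n))\<^sup>2) \<le> e\<^sup>2"
      unfolding eventually_sequentially
    proof (intro exI allI impI)
      fix j assume "j \<ge> M"
      hence "norm (X i - X j) \<le> e" using M \<open>i \<ge> M\<close> by (auto simp: dist_norm less_imp_le)
      thus "(\<Sum>n\<in>F. (cmod (seq_of (X i) n - seq_of (X j) n))\<^sup>2) \<le> e\<^sup>2"
        using sum_le_norm_l2_sq[OF \<open>finite F\<close>, of "X i - X j"]
          power_mono[OF _ norm_ge_zero, of "X i - X j" e 2]
        by simp
    qed
  qed auto
  obtain M where M: "\<forall>i\<ge>M. \<forall>j\<ge>M. dist (X i) (X j) < 1"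
    using X unfolding Cauchy_def by (meson zero_less_one)
  have "(\<lambda>n. seq_of (X M) n - y n) \<in> ell2"
    using tail[OF M order_refl] by (rule ell2_boundI(1))
  \<comment> \<open>The limit is \<open>X M\<close> minus a sequence just shown to be
    square-summable.\<close>
  from ell2_add[OF seq_of[of "X M"] ell2_scale[OF this, of "-1"]]
  have y_in: "y \<in> ell2" by simp
  have "X \<longlonglongrightarrow> l2_of y"
  proof (rule metric_LIMSEQ_I)
    fix e :: real assume e: "e > 0"
    then obtain N where N: "\<forall>i\<ge>N. \<forall>j\<ge>N. dist (X i) (X j) < e / 2"
      using X unfolding Cauchy_def by (meson half_gt_zero)
    have "norm (X i - l2_of y) \<le> e / 2" if "i \<ge> N" for i
    proof (rule norm_l2_leI)
      show "(\<Sum>n\<in>F. (cmod (seq_of (X i - l2_of y) n))\<^sup>2) \<le> (e / 2)\<^sup>2" if "finite F" for F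
        using tail[OF N \<open>i \<ge> N\<close> that] y_in by (simp only: seq_of_simps l2_of_inverse)
    qed (use e in simp)
    thus "\<exists>N. \<forall>i\<ge>N. dist (X i) (l2_of y) < e"
      using e by (intro exI[of _ N]) (force simp: dist_norm)
  qed
  thus "convergent X" by (auto simp: convergent_def)
qed

instance l2 :: banach ..

section \<open>Kernel operators and the Schur test\<close>

text \<open>Bounding finite partial sums makes the condition self-contained, since absolute
  summability of rows and columns follows. A single constant serves both directions and is then a
  bound for the operator norm. Real kernels suffice because h and the Green function at a real \<mu>
  outside [0,4] are real.\<close>

definition schur :: "(int \<Rightarrow> int \<Rightarrow> real) \<Rightarrow> real \<Rightarrow> bool" where
  "schur k M \<longleftrightarrow> (\<forall>n F. finite F \<longrightarrow> (\<Sum>m\<in>F. \<bar>k n m\<bar>) \<le> M) \<and>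
                 (\<forall>m F. finite F \<longrightarrow> (\<Sum>n\<in>F. \<bar>k n m\<bar>) \<le> M)"

lemma schur_row: "schur k M \<Longrightarrow> finite F \<Longrightarrow> (\<Sum>m\<in>F. \<bar>k n m\<bar>) \<le> M"
  and schur_column: "schur k M \<Longrightarrow> finite F \<Longrightarrow> (\<Sum>n\<in>F. \<bar>k n m\<bar>) \<le> M"
  by (auto simp: schur_def)

lemma schur_nonneg: "schur k M \<Longrightarrow> 0 \<le> M"
  using schur_row[of k M "{}"] by simp

lemma schur_mono: "schur k M \<Longrightarrow> M \<le> N \<Longrightarrow> schur k N"
  unfolding schur_def by (meson order_trans)

lemma schur_transpose: "schur k M \<Longrightarrow> schur (\<lambda>n m. k m n) M"
  by (auto simp: schur_def)

lemma schur_diff: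
  assumes "schur k M" "schur l N"
  shows "schur (\<lambda>n m. k n m - l n m) (M + N)"
proof -
  have "(\<Sum>m\<in>F. \<bar>k n m - l n m\<bar>) \<le> M + N" if "finite F" for n F
    using sum_mono[of F "\<lambda>m. \<bar>k n m - l n m\<bar>" "\<lambda>m. \<bar>k n m\<bar> + \<bar>l n m\<bar>"]
      schur_row[OF assms(1) that, of n] schur_row[OF assms(2) that, of n]
    by (simp add: sum.distrib abs_triangle_ineq4)
  moreover have "(\<Sum>n\<in>F. \<bar>k n m - l n m\<bar>) \<le> M + N" if "finite F" for m F
    using sum_mono[of F "\<lambda>n. \<bar>k n m - l n m\<bar>" "\<lambda>n. \<bar>k n m\<bar> + \<bar>l n m\<bar>"]
      schur_column[OF assms(1) that, of m] schur_column[OF assms(2) that, of m]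
    by (simp add: sum.distrib abs_triangle_ineq4)
  ultimately show ?thesis by (simp add: schur_def)
qed

definition kernel_apply :: "(int \<Rightarrow> int \<Rightarrow> real) \<Rightarrow> seq_op" where
  "kernel_apply k \<psi> n = (\<Sum>\<^sub>\<infinity>m. complex_of_real (k n m) * \<psi> m)"

lemma schur_abs_summable:
  assumes "schur k M"
  shows "(\<lambda>m. cmod (complex_of_real (k n m) * seq_of x m)) summable_on UNIV"
proof (rule nonneg_bdd_above_summable_on)
  show "bdd_above (sum (\<lambda>m. cmod (complex_of_real (k n m) * seq_of x m)) ` {F. F \<subseteq> UNIV \<and> finite F})"
  proof (rule bdd_aboveI[where M = "M * norm x"], clarify)
    fix F :: "int set" assume "finite F"
    have "(\<Sum>m\<in>F. cmod (complex_of_real (k n m) * seq_of x m)) \<le> (\<Sum>m\<in>F. \<bar>k n m\<bar> * norm x)"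
      by (intro sum_mono) (simp add: norm_mult mult_left_mono cmod_seq_of_le)
    also have "\<dots> \<le> M * norm x"
      using schur_row[OF assms \<open>finite F\<close>] by (simp add: mult_right_mono flip: sum_distrib_right)
    finally show "(\<Sum>m\<in>F. cmod (complex_of_real (k n m) * seq_of x m)) \<le> M * norm x" .
  qed
qed auto

lemmas schur_summable = abs_summable_summable[OF schur_abs_summable]

lemma schur_abs_le: "schur k M \<Longrightarrow> \<bar>k n m\<bar> \<le> M"
  using schur_row[of k M "{m}" n] by simp

lemma schur_sq_summable:
  assumes "schur k M"
  shows "(\<lambda>m. \<bar>k n m\<bar> * (cmod (seq_of x m))\<^sup>2) summable_on UNIV"
  by (rule summable_on_comparison_test[OF summable_on_cmult_right[OF seq_of_summable[of x], of M]])
     (auto intro!: mult_right_mono schur_abs_le[OF assms])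

text \<open>The half of the Schur test that uses rows: with |k| split as sqrt |k| times sqrt |k|,
  Cauchy-Schwarz separates a row sum, at most M, from a square sum weighted by |k|.\<close>

lemma cmod_kernel_apply_sq_le:
  assumes "schur k M"
  shows "(cmod (kernel_apply k (seq_of x) n))\<^sup>2 \<le>
           M * (\<Sum>\<^sub>\<infinity>m. \<bar>k n m\<bar> * (cmod (seq_of x m))\<^sup>2)" (is "_ \<le> M * ?s")
proof -
  have s: "0 \<le> ?s" by (rule infsum_nonneg) auto
  have "cmod (kernel_apply k (seq_of x) n) \<le> (\<Sum>\<^sub>\<infinity>m. cmod (complex_of_real (k n m) * seq_of x m))"
    unfolding kernel_apply_def by (rule norm_infsum_bound[OF schur_abs_summable[OF assms]])
  also have "\<dots> \<le> sqrt (M * ?s)"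
  proof (rule infsum_le_finite_sums[OF schur_abs_summable[OF assms]])
    fix E :: "int set" assume E: "finite E"
    have "(\<Sum>m\<in>E. cmod (complex_of_real (k n m) * seq_of x m))\<^sup>2 =
          (\<Sum>m\<in>E. sqrt \<bar>k n m\<bar> * (sqrt \<bar>k n m\<bar> * cmod (seq_of x m)))\<^sup>2"
      by (simp add: norm_mult flip: mult.assoc)
    also have "\<dots> \<le> (\<Sum>m\<in>E. (sqrt \<bar>k n m\<bar>)\<^sup>2) * (\<Sum>m\<in>E. (sqrt \<bar>k n m\<bar> * cmod (seq_of x m))\<^sup>2)"
      by (rule Cauchy_Schwarz_ineq_sum)
    also have "\<dots> = (\<Sum>m\<in>E. \<bar>k n m\<bar>) * (\<Sum>m\<in>E. \<bar>k n m\<bar> * (cmod (seq_of x m))\<^sup>2)"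
      by (simp add: power_mult_distrib)
    also have "\<dots> \<le> M * ?s"
      using E schur_nonneg[OF assms]
      by (intro mult_mono schur_row[OF assms] finite_sum_le_infsum schur_sq_summable[OF assms] sum_nonneg)
         auto
    finally show "(\<Sum>m\<in>E. cmod (complex_of_real (k n m) * seq_of x m)) \<le> sqrt (M * ?s)"
      by (rule real_le_rsqrt)
  qed
  finally have "(cmod (kernel_apply k (seq_of x) n))\<^sup>2 \<le> (sqrt (M * ?s))\<^sup>2"
    by (rule power_mono) simp
  thus ?thesis using s schur_nonneg[OF assms] by simp
qed

lemma sum_infsum_swap:
  fixes f :: "'a \<Rightarrow> 'b \<Rightarrow> 'c::{topological_comm_monoid_add, t2_space}"
  assumes "finite F" "\<And>n. n \<in> F \<Longrightarrow> f n summable_on A"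
  shows "(\<lambda>m. \<Sum>n\<in>F. f n m) summable_on A \<and> (\<Sum>n\<in>F. infsum (f n) A) = (\<Sum>\<^sub>\<infinity>m\<in>A. \<Sum>n\<in>F. f n m)"
  using assms by (induction F) (auto simp: infsum_add summable_on_add)

text \<open>The half of the Schur test that uses columns: after summing the row estimate over n and
  exchanging the sums, the weights add up to column sums and give the second factor M. Only finitely
  many rows are summed, so the exchange involves one infinite sum at a time.\<close>

lemma kernel_apply_sum_le:
  assumes "schur k M" "finite F"
  shows "(\<Sum>n\<in>F. (cmod (kernel_apply k (seq_of x) n))\<^sup>2) \<le> (M * norm x)\<^sup>2"
proof -
  note swap = sum_infsum_swap[OF assms(2) schur_sq_summable[OF assms(1)], of "\<lambda>n. n" "\<lambda>_. x"]
  have "(\<Sum>n\<in>F. (cmod (kernel_apply k (seq_of x) n))\<^sup>2) \<le>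
        (\<Sum>n\<in>F. M * (\<Sum>\<^sub>\<infinity>m. \<bar>k n m\<bar> * (cmod (seq_of x m))\<^sup>2))"
    by (intro sum_mono cmod_kernel_apply_sq_le assms)
  also have "\<dots> = M * (\<Sum>\<^sub>\<infinity>m. \<Sum>n\<in>F. \<bar>k n m\<bar> * (cmod (seq_of x m))\<^sup>2)"
    using swap by (simp flip: sum_distrib_left)
  also have "(\<Sum>\<^sub>\<infinity>m. \<Sum>n\<in>F. \<bar>k n m\<bar> * (cmod (seq_of x m))\<^sup>2) \<le> (\<Sum>\<^sub>\<infinity>m. M * (cmod (seq_of x m))\<^sup>2)"
    using swap schur_column[OF assms]
    by (intro infsum_mono summable_on_cmult_right seq_of_summable)
       (auto simp: mult_right_mono simp flip: sum_distrib_right)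
  also have "\<dots> = M * (norm x)\<^sup>2" by (simp add: infsum_cmult_right' norm_l2_sq)
  also have "M * (M * (norm x)\<^sup>2) = (M * norm x)\<^sup>2" by (simp add: power2_eq_square)
  finally show ?thesis by (simp add: mult_left_mono schur_nonneg[OF assms(1)])
qed

lemma kernel_apply_ell2: "schur k M \<Longrightarrow> kernel_apply k (seq_of x) \<in> ell2"
  by (rule ell2_boundI(1)) (rule kernel_apply_sum_le)

text \<open>\<open>Blinfun\<close> yields the intended operator only once the map is known to be
  linear and bounded; hence the Schur bound fixed in the context that follows.\<close>

definition kernel_op :: "(int \<Rightarrow> int \<Rightarrow> real) \<Rightarrow> l2 \<Rightarrow>\<^sub>L l2" where
  "kernel_op k = Blinfun (\<lambda>x. l2_of (kernel_apply k (seq_of x)))"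

context
  fixes k :: "int \<Rightarrow> int \<Rightarrow> real" and M :: real
  assumes k: "schur k M"
begin

lemma kernel_op_apply: "kernel_op k x = l2_of (kernel_apply k (seq_of x))"
proof -
  have "bounded_linear (\<lambda>x. l2_of (kernel_apply k (seq_of x)))"
  proof (rule bounded_linear_intro)
    fix x y :: l2 and r :: real
    show "l2_of (kernel_apply k (seq_of (x + y))) =
          l2_of (kernel_apply k (seq_of x)) + l2_of (kernel_apply k (seq_of y))"
      by (rule l2_eqI) (simp add: l2_of_inverse kernel_apply_ell2[OF k] kernel_apply_def
          distrib_left infsum_add[OF schur_summable[OF k] schur_summable[OF k]])
    show "l2_of (kernel_apply k (seq_of (r *\<^sub>R x))) = r *\<^sub>R l2_of (kernel_apply k (seq_of x))"
      by (rule l2_eqI) (simp add: l2_of_inverse kernel_apply_ell2[OF k] kernel_apply_def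
          mult.left_commute infsum_cmult_right')
    show "norm (l2_of (kernel_apply k (seq_of x))) \<le> norm x * M"
      by (rule norm_l2_leI)
         (auto simp: l2_of_inverse kernel_apply_ell2[OF k] schur_nonneg[OF k] mult.commute[of _ M]
            intro: kernel_apply_sum_le[OF k])
  qed
  thus ?thesis by (simp add: kernel_op_def bounded_linear_Blinfun_apply)
qed

lemma seq_of_kernel_op: "seq_of (kernel_op k x) = kernel_apply k (seq_of x)"
  by (simp add: kernel_op_apply l2_of_inverse kernel_apply_ell2[OF k])

lemma norm_kernel_op: "norm (kernel_op k) \<le> M"
  by (rule norm_blinfun_bound)
     (auto simp: seq_of_kernel_op schur_nonneg[OF k] intro!: norm_l2_leI kernel_apply_sum_le[OF k])

lemma inner_kernel_op:
  "kernel_op k x \<bullet> y = (\<Sum>\<^sub>\<infinity>n. \<Sum>\<^sub>\<infinity>m. k n m * (seq_of x m \<bullet> seq_of y n))"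
proof -
  have "kernel_apply k (seq_of x) n \<bullet> seq_of y n = (\<Sum>\<^sub>\<infinity>m. k n m * (seq_of x m \<bullet> seq_of y n))" for n
    using has_sum_bounded_linear[OF bounded_linear_inner_left[of "seq_of y n"]
        has_sum_infsum[OF schur_summable[OF k, of n x]], THEN infsumI]
    by (simp add: kernel_apply_def flip: scaleR_conv_of_real)
  thus ?thesis by (simp add: inner_l2_def seq_of_kernel_op)
qed

text \<open>This justifies the exchange of sums behind \<open>inner_kernel_op_transpose\<close>. The
  product of two coordinates is dominated by their squares; column sums handle the squares of x, row
  sums those of y.\<close>

lemma kernel_op_swap_summable:
  "(\<lambda>(n, m). k n m * (seq_of x m \<bullet> seq_of y n)) summable_on UNIV \<times> UNIV"
proof (rule abs_summable_summable, rule nonneg_bdd_above_summable_on)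
  let ?f = "\<lambda>p. norm (case p of (n, m) \<Rightarrow> k n m * (seq_of x m \<bullet> seq_of y n))"
  show "bdd_above (sum ?f ` {P. P \<subseteq> UNIV \<times> UNIV \<and> finite P})"
  proof (rule bdd_aboveI[where M = "M * (norm x)\<^sup>2 + M * (norm y)\<^sup>2"], clarify)
    fix P :: "(int \<times> int) set" assume P: "finite P"
    define F E where "F = fst ` P" and "E = snd ` P"
    have fin: "finite F" "finite E" using P by (auto simp: F_def E_def)
    have b: "?f (n, m) \<le> \<bar>k n m\<bar> * (cmod (seq_of x m))\<^sup>2 + \<bar>k n m\<bar> * (cmod (seq_of y n))\<^sup>2" for n m
      using mult_left_mono[OF abs_inner_le_sum_squares[of "seq_of x m" "seq_of y n"], of "\<bar>k n m\<bar>"]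
      by (simp add: abs_mult distrib_left)
    \<comment> \<open>A finite set of pairs lies in the rectangle of its projections, where the sum
      can be iterated.\<close>
    have "sum ?f P \<le> sum ?f (F \<times> E)"
      by (rule sum_mono2) (use fin in \<open>auto simp: F_def E_def intro: rev_image_eqI\<close>)
    also have "\<dots> = (\<Sum>n\<in>F. \<Sum>m\<in>E. ?f (n, m))" by (simp add: sum.cartesian_product case_prod_unfold)
    also have "\<dots> \<le> (\<Sum>n\<in>F. \<Sum>m\<in>E. \<bar>k n m\<bar> * (cmod (seq_of x m))\<^sup>2 + \<bar>k n m\<bar> * (cmod (seq_of y n))\<^sup>2)"
      by (intro sum_mono b)
    also have "\<dots> = (\<Sum>m\<in>E. (\<Sum>n\<in>F. \<bar>k n m\<bar>) * (cmod (seq_of x m))\<^sup>2) +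
                   (\<Sum>n\<in>F. (\<Sum>m\<in>E. \<bar>k n m\<bar>) * (cmod (seq_of y n))\<^sup>2)"
      by (simp add: sum.distrib sum_distrib_right sum.swap[of _ F E])
    also have "\<dots> \<le> (\<Sum>m\<in>E. M * (cmod (seq_of x m))\<^sup>2) + (\<Sum>n\<in>F. M * (cmod (seq_of y n))\<^sup>2)"
      by (intro add_mono sum_mono mult_right_mono schur_row[OF k] schur_column[OF k] fin) auto
    also have "\<dots> \<le> M * (norm x)\<^sup>2 + M * (norm y)\<^sup>2"
      unfolding sum_distrib_left[symmetric]
      by (intro add_mono mult_left_mono sum_le_norm_l2_sq fin schur_nonneg[OF k])
    finally show "sum ?f P \<le> M * (norm x)\<^sup>2 + M * (norm y)\<^sup>2" .
  qed
qed auto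

end

lemma inner_kernel_op_transpose:
  assumes "schur k M"
  shows "kernel_op k x \<bullet> y = x \<bullet> kernel_op (\<lambda>n m. k m n) y"
  using infsum_swap_banach[OF kernel_op_swap_summable[OF assms, of x y]]
  by (simp add: inner_commute[of x] inner_kernel_op[OF assms] inner_kernel_op[OF schur_transpose[OF assms]]
      inner_commute[of "seq_of y _"])

lemma kernel_op_diff:
  assumes "schur k M" "schur l N"
  shows "kernel_op (\<lambda>n m. k n m - l n m) = kernel_op k - kernel_op l"
proof (rule blinfun_eqI, rule l2_eqI)
  fix x n
  have "(\<Sum>\<^sub>\<infinity>m. complex_of_real (k n m) * seq_of x m + - (complex_of_real (l n m) * seq_of x m)) =
     (\<Sum>\<^sub>\<infinity>m. complex_of_real (k n m) * seq_of x m) + (\<Sum>\<^sub>\<infinity>m. - (complex_of_real (l n m) * seq_of x m))"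
    by (intro infsum_add summable_on_uminus[THEN iffD2] schur_summable[OF assms(1)] schur_summable[OF assms(2)])
  thus "seq_of (kernel_op (\<lambda>n m. k n m - l n m) x) n = seq_of ((kernel_op k - kernel_op l) x) n"
    by (simp add: blinfun.diff_left seq_of_kernel_op[OF schur_diff[OF assms]]
        seq_of_kernel_op[OF assms(1)] seq_of_kernel_op[OF assms(2)] kernel_apply_def
        left_diff_distrib infsum_uminus)
qed

section \<open>Bounded invertibility\<close>

text \<open>The inequality is the boundedness of the inverse, read at T x; it mirrors the bound
  demanded in \<open>resolvent_set\<close>.\<close>

definition boundedly_invertible :: "('a::real_normed_vector \<Rightarrow> 'a) \<Rightarrow> bool" where
  "boundedly_invertible T \<longleftrightarrow> bij T \<and> (\<exists>C. \<forall>x. norm x \<le> C * norm (T x))"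

text \<open>Solving T x = y amounts to finding a fixed point of x - R (T x - y), a contraction with
  factor q. Injectivity of R turns a fixed point into a solution, and the same estimate for x - R (T
  x) bounds x by T x. Both the openness of invertibility and the exclusion of non-real spectrum rest
  on this, with different choices of R.\<close>

lemma boundedly_invertible_approx_inverse:
  fixes T R :: "'a::banach \<Rightarrow>\<^sub>L 'a"
  assumes R: "\<And>x. R x = 0 \<Longrightarrow> x = 0"
    and q: "q < 1" "\<And>x. norm (x - R (T x)) \<le> q * norm x"
  shows "boundedly_invertible T"
proof -
  have bound: "norm x \<le> norm R / (1 - q) * norm (T x)" for x
  proof -
    have "norm x \<le> norm (x - R (T x)) + norm (R (T x))"
      using norm_triangle_ineq[of "x - R (T x)" "R (T x)"] by simp
    also have "\<dots> \<le> q * norm x + norm R * norm (T x)"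
      by (intro add_mono q(2) norm_blinfun)
    finally show ?thesis using q(1) by (simp add: field_simps)
  qed
  have "inj T"
  proof (rule injI)
    fix x y assume "T x = T y"
    thus "x = y" using bound[of "x - y"] by (simp add: blinfun.diff_right)
  qed
  moreover have "surj T"
    unfolding surj_def
  proof
    fix y
    define f where "f x = x - R (T x - y)" for x
    \<comment> \<open>The fixed point theorem asks for a nonnegative factor, and q carries no sign
      assumption.\<close>
    have "dist (f u) (f v) \<le> max q 0 * dist u v" for u v
    proof -
      have "f u - f v = (u - v) - R (T (u - v))"
        by (simp add: f_def blinfun.diff_right)
      hence "dist (f u) (f v) \<le> q * dist u v"
        using q(2)[of "u - v"] by (simp add: dist_norm)
      also have "\<dots> \<le> max q 0 * dist u v" by (intro mult_right_mono) auto
      finally show ?thesis .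
    qed
    then obtain x where "f x = x"
      using banach_fix_type[of "max q 0" f] q(1) by auto
    hence "R (T x - y) = 0" by (simp add: f_def)
    hence "T x - y = 0" by (rule R)
    thus "\<exists>x. y = T x" by auto
  qed
  ultimately show ?thesis
    using bound unfolding boundedly_invertible_def bij_def by blast
qed

text \<open>The inverse of S is an approximate inverse of every T near S: if \<open>C'\<close>
  bounds this inverse, then distance less than 1 / (2 * \<open>C'\<close>) gives contraction factor
  1/2.\<close>

lemma open_boundedly_invertible:
  "open {T :: 'a::banach \<Rightarrow>\<^sub>L 'a. boundedly_invertible T}"
  unfolding open_dist
proof (intro ballI)
  fix S :: "'a \<Rightarrow>\<^sub>L 'a" assume "S \<in> {T. boundedly_invertible (blinfun_apply T)}"
  then obtain C where bij: "bij S" and C: "\<And>x. norm x \<le> C * norm (S x)"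
    by (auto simp: boundedly_invertible_def)
  \<comment> \<open>The constant C may fail to be positive; enlarging it makes the radius 1 / (2 *
    \<open>C'\<close>) well defined and positive.\<close>
  define C' where "C' = max C 1"
  have C': "norm x \<le> C' * norm (S x)" for x
    using C[of x] mult_right_mono[of C C' "norm (S x)"] by (simp add: C'_def)
  have inv: "S (inv S x) = x" "inv S (S x) = x" for x
    using bij by (simp_all add: surj_f_inv_f bij_is_surj bij_is_inj)
  have "bounded_linear (inv S)"
  proof (rule bounded_linear_intro)
    show "inv S (x + y) = inv S x + inv S y" for x y
      by (metis blinfun.add_right inv)
    show "inv S (r *\<^sub>R x) = r *\<^sub>R inv S x" for r x
      by (metis blinfun.scaleR_right inv)
    show "norm (inv S x) \<le> norm x * C'" for x
      using C'[of "inv S x"] by (simp add: inv mult.commute)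
  qed
  hence R: "Blinfun (inv S) x = inv S x" for x
    by (simp add: bounded_linear_Blinfun_apply)
  show "\<exists>e>0. \<forall>T. dist T S < e \<longrightarrow> T \<in> {T. boundedly_invertible (blinfun_apply T)}"
  proof (intro exI[of _ "1 / (2 * C')"] conjI allI impI CollectI)
    show "0 < 1 / (2 * C')" by (simp add: C'_def)
    fix T assume T: "dist T S < 1 / (2 * C')"
    show "boundedly_invertible T"
    proof (rule boundedly_invertible_approx_inverse[where R = "Blinfun (inv S)" and q = "1/2"])
      show "x = 0" if "Blinfun (inv S) x = 0" for x
        using that inv(1)[of x] by (simp add: R)
      fix x
      have "x - inv S (T x) = inv S (S x - T x)"
        using \<open>bounded_linear (inv S)\<close> by (simp add: linear_simps inv)
      also have "norm \<dots> \<le> C' * norm ((S - T) x)"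
        using C'[of "inv S (S x - T x)"] by (simp add: inv blinfun.diff_left)
      also have "\<dots> \<le> C' * (norm (S - T) * norm x)"
        by (intro mult_left_mono norm_blinfun) (simp add: C'_def)
      also have "\<dots> = (C' * norm (S - T)) * norm x" by simp
      also have "\<dots> \<le> 1/2 * norm x"
        using T by (intro mult_right_mono) (auto simp: C'_def dist_norm norm_minus_commute field_simps)
      finally show "norm (x - Blinfun (inv S) (T x)) \<le> 1/2 * norm x" by (simp add: R)
    qed simp
  qed
qed

lemma boundedly_invertible_conj:
  assumes "boundedly_invertible T" "bij U" "\<And>x. norm (U x) = norm x" "\<And>x. S (U x) = U (T x)"
  shows "boundedly_invertible S"
proof -
  obtain C where "bij T" and C: "\<And>x. norm x \<le> C * norm (T x)"
    using assms(1) by (auto simp: boundedly_invertible_def)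
  have "S = U \<circ> T \<circ> inv U"
    using assms(2,4) by (auto simp: fun_eq_iff surj_f_inv_f bij_is_surj simp flip: assms(4))
  hence "bij S" using \<open>bij T\<close> assms(2) by (simp add: bij_comp bij_imp_bij_inv)
  moreover have "norm y \<le> C * norm (S y)" for y
  proof -
    obtain x where "y = U x" using assms(2) by (metis bij_pointE)
    thus ?thesis using C[of x] by (simp add: assms)
  qed
  ultimately show ?thesis by (auto simp: boundedly_invertible_def)
qed

text \<open>Since \<open>seq_of\<close> is a bijection onto \<open>ell2\<close>, it conjugates T to
  the restriction of A - z. Bijectivity transfers directly; the resolvent bound becomes the lower
  bound on T by writing each sequence as the image of T x.\<close>

lemma mem_resolvent_set_iff:
  assumes T: "\<And>x. seq_of (T x) = minus_scalar A z (seq_of x)"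
  shows "z \<in> resolvent_set A \<longleftrightarrow> boundedly_invertible T"
proof -
  have seq_of_bij: "bij_betw seq_of UNIV ell2"
    by (metis bij_betw_def inj_on_def seq_of_inject type_definition.Rep_range type_definition_l2)
  have "minus_scalar A z \<circ> seq_of = seq_of \<circ> T"
    by (auto simp: T)
  hence "bij_betw (minus_scalar A z) ell2 ell2 \<longleftrightarrow> bij_betw (seq_of \<circ> T) UNIV ell2"
    using bij_betw_comp_iff[OF seq_of_bij] by metis
  also have "\<dots> \<longleftrightarrow> bij T"
    using bij_betw_comp_iff2[OF seq_of_bij, of T UNIV] by auto
  finally have bij: "bij_betw (minus_scalar A z) ell2 ell2 \<longleftrightarrow> bij T" .
  have "(\<forall>\<psi>\<in>ell2. ell2_norm (resolvent A z \<psi>) \<le> C * ell2_norm \<psi>) \<longleftrightarrow>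
        (\<forall>x. norm x \<le> C * norm (T x))" if "bij T" for C
  proof -
    have "(\<forall>\<psi>\<in>ell2. P \<psi>) \<longleftrightarrow> (\<forall>x. P (seq_of (T x)))" for P
      using that seq_of_bij by (metis UNIV_I bij_betw_imp_surj_on bij_pointE imageE seq_of)
    moreover have "resolvent A z (seq_of (T x)) = seq_of x" for x
      unfolding resolvent_def T
      using bij that by (intro inv_into_f_f seq_of) (simp add: bij_betw_def)
    ultimately show ?thesis by (simp add: norm_l2_eq)
  qed
  thus ?thesis by (auto simp: resolvent_set_def boundedly_invertible_def bij)
qed

section \<open>Complex scalars, and invertibility at non-real spectral parameters\<close>

lift_definition cmul :: "complex \<Rightarrow> l2 \<Rightarrow> l2" is "\<lambda>c \<psi> n. c * \<psi> n"
  by (rule ell2_scale)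

lemma seq_of_cmul [simp]: "seq_of (cmul c x) n = c * seq_of x n"
  by (simp add: cmul.rep_eq)

lemma inner_cmul: "cmul c x \<bullet> y = x \<bullet> cmul (cnj c) y"
  by (simp add: inner_l2_def inner_complex_def algebra_simps)

lemma norm_cmul: "norm (cmul c x) = cmod c * norm x"
proof (rule power2_eq_imp_eq)
  show "(norm (cmul c x))\<^sup>2 = (cmod c * norm x)\<^sup>2"
    by (simp add: norm_l2_sq norm_mult power_mult_distrib infsum_cmult_right')
qed auto

lemma bounded_linear_cmul: "bounded_linear (cmul c)"
  by (rule bounded_linear_intro[where K = "cmod c"])
     (auto intro!: l2_eqI simp: algebra_simps norm_cmul)

definition cmul_op :: "complex \<Rightarrow> l2 \<Rightarrow>\<^sub>L l2" where
  "cmul_op c = Blinfun (cmul c)"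

lemma cmul_op_apply [simp]: "cmul_op c x = cmul c x"
  by (simp add: cmul_op_def bounded_linear_Blinfun_apply bounded_linear_cmul)

lemma norm_diff_sq_orthogonal:
  fixes u w :: "'a::real_inner"
  shows "u \<bullet> w = 0 \<Longrightarrow> (norm (u - w))\<^sup>2 = (norm u)\<^sup>2 + (norm w)\<^sup>2"
  by (simp add: power2_norm_eq_inner inner_diff_left inner_diff_right inner_commute)

lemma symmetric_nonreal_boundedly_invertible:
  fixes A :: "l2 \<Rightarrow>\<^sub>L l2"
  assumes sym: "\<And>x y. A x \<bullet> y = x \<bullet> A y"
    and comm: "\<And>x. A (cmul \<i> x) = cmul \<i> (A x)"
    and "Im z \<noteq> 0"
  shows "boundedly_invertible (A - cmul_op z)"
proof -
  define v where "v = Im z"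
  \<comment> \<open>The real part of z is absorbed into B, which stays symmetric and commutes with
    \<i>; what is left of z is \<i> times v.\<close>
  define B where "B = A - Re z *\<^sub>R id_blinfun"
  define a where "a = norm B"
  define t where "t = v / (v\<^sup>2 + a\<^sup>2)"
  have v: "v \<noteq> 0" using assms(3) by (simp add: v_def)
  have va: "v\<^sup>2 + a\<^sup>2 > 0" using v by (simp add: add_pos_nonneg)
  have "t \<noteq> 0" using v va by (simp add: t_def)
  have B: "B x \<bullet> y = x \<bullet> B y" "B (cmul \<i> x) = cmul \<i> (B x)" for x y
    by (auto simp: B_def blinfun.diff_left blinfun.scaleR_left inner_diff sym comm
        algebra_simps intro!: l2_eqI)
  have T: "(A - cmul_op z) x = B x - v *\<^sub>R cmul \<i> x" for x
  proof (rule l2_eqI)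
    fix n
    have "z * w = of_real (Re z) * w + of_real v * (\<i> * w)" for w
      by (simp add: v_def complex_eq_iff)
    thus "seq_of ((A - cmul_op z) x) n = seq_of (B x - v *\<^sub>R cmul \<i> x) n"
      by (simp add: B_def blinfun.diff_left blinfun.scaleR_left)
  qed
  \<comment> \<open>Since \<open>x\<close> and \<open>\<i> B x\<close> are orthogonal, a small multiple of \<open>\<i>\<close> is an approximate inverse of
    \<open>A - z = B - \<i> v\<close>; \<open>t\<close> minimises the resulting contraction factor.\<close>
  show ?thesis
  proof (rule boundedly_invertible_approx_inverse[where R = "cmul_op (\<i> * of_real t)"])
    show "x = 0" if "cmul_op (\<i> * of_real t) x = 0" for x
      using norm_cmul[of "\<i> * of_real t" x] that \<open>t \<noteq> 0\<close> by (simp add: norm_mult)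
    show "sqrt (1 - v\<^sup>2 / (v\<^sup>2 + a\<^sup>2)) < 1" using v va by simp
    fix x
    have eq: "x - cmul_op (\<i> * of_real t) ((A - cmul_op z) x) = (1 - t * v) *\<^sub>R x - t *\<^sub>R cmul \<i> (B x)"
      by (rule l2_eqI) (simp add: T algebra_simps)
    \<comment> \<open>Moving \<i> across the inner product conjugates it, while B moves across
      unchanged. The real inner product thus equals its own negative and vanishes.\<close>
    have "cmul \<i> (B x) \<bullet> x = - (x \<bullet> cmul \<i> (B x))"
    proof -
      have "cmul \<i> (B x) \<bullet> x = B x \<bullet> cmul (- \<i>) x" by (simp add: inner_cmul)
      also have "cmul (- \<i>) x = - cmul \<i> x" by (rule l2_eqI) simp
      also have "B x \<bullet> - cmul \<i> x = - (x \<bullet> cmul \<i> (B x))" by (simp add: B)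
      finally show ?thesis .
    qed
    hence orth: "x \<bullet> cmul \<i> (B x) = 0" by (simp add: inner_commute)
    have "(norm ((1 - t * v) *\<^sub>R x - t *\<^sub>R cmul \<i> (B x)))\<^sup>2 =
        (1 - t * v)\<^sup>2 * (norm x)\<^sup>2 + t\<^sup>2 * (norm (B x))\<^sup>2"
    proof -
      have "(norm ((1 - t * v) *\<^sub>R x - t *\<^sub>R cmul \<i> (B x)))\<^sup>2 =
        (norm ((1 - t * v) *\<^sub>R x))\<^sup>2 + (norm (t *\<^sub>R cmul \<i> (B x)))\<^sup>2"
        using orth by (intro norm_diff_sq_orthogonal) simp
      thus ?thesis by (simp add: norm_cmul power_mult_distrib)
    qed
    also have "\<dots> \<le> (1 - t * v)\<^sup>2 * (norm x)\<^sup>2 + t\<^sup>2 * (a * norm x)\<^sup>2"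
      by (intro add_left_mono mult_left_mono power_mono) (auto simp: a_def norm_blinfun)
    also have "\<dots> = (1 - 2 * t * v + t\<^sup>2 * (v\<^sup>2 + a\<^sup>2)) * (norm x)\<^sup>2"
      by (simp add: power2_eq_square algebra_simps)
    also have "1 - 2 * t * v + t\<^sup>2 * (v\<^sup>2 + a\<^sup>2) = 1 - v\<^sup>2 / (v\<^sup>2 + a\<^sup>2)"
    proof -
      have "1 - 2 * (v / d) * v + (v / d)\<^sup>2 * d = 1 - v\<^sup>2 / d" if "d > 0" for d
        using that by (simp add: power2_eq_square field_simps)
      from this[OF va] show ?thesis by (simp only: t_def)
    qed
    finally have "norm ((1 - t * v) *\<^sub>R x - t *\<^sub>R cmul \<i> (B x)) \<le>
        sqrt ((1 - v\<^sup>2 / (v\<^sup>2 + a\<^sup>2)) * (norm x)\<^sup>2)"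
      by (rule real_le_rsqrt)
    thus "norm (x - cmul_op (\<i> * of_real t) ((A - cmul_op z) x)) \<le>
        sqrt (1 - v\<^sup>2 / (v\<^sup>2 + a\<^sup>2)) * norm x"
      by (simp only: eq real_sqrt_mult real_sqrt_abs abs_norm_cancel)
  qed
qed

section \<open>Shifts and the Laplacian as bounded operators\<close>

lift_definition shift :: "int \<Rightarrow> l2 \<Rightarrow> l2" is "\<lambda>j \<psi> n. \<psi> (n + j)"
  unfolding ell2_iff by (subst summable_on_reindex_bij_betw[OF bij_plus_right])

lemma seq_of_shift [simp]: "seq_of (shift j x) n = seq_of x (n + j)"
  by (simp add: shift.rep_eq)

lemma norm_shift: "norm (shift j x) = norm x"
proof (rule power2_eq_imp_eq)
  show "(norm (shift j x))\<^sup>2 = (norm x)\<^sup>2"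
    using infsum_reindex_bij_betw[OF bij_plus_right[of j], of "\<lambda>n. (cmod (seq_of x n))\<^sup>2"]
    by (simp add: norm_l2_sq)
qed auto

lemma bij_shift: "bij (shift j)"
  by (rule bij_betw_byWitness[where f' = "shift (- j)"]) (auto intro!: l2_eqI)

lemma bounded_linear_shift: "bounded_linear (shift j)"
  by (rule bounded_linear_intro[where K = 1]) (auto intro!: l2_eqI simp: norm_shift)

lemma inner_shift: "shift j x \<bullet> y = x \<bullet> shift (- j) y"
  using infsum_reindex_bij_betw[OF bij_plus_right[of j], of "\<lambda>n. seq_of x n \<bullet> seq_of y (n - j)"]
  by (simp add: inner_l2_def)

definition neg_laplacian_op :: "l2 \<Rightarrow>\<^sub>L l2" where
  "neg_laplacian_op = 2 *\<^sub>R id_blinfun - Blinfun (shift 1) - Blinfun (shift (- 1))"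

lemma neg_laplacian_op_apply: "neg_laplacian_op x = 2 *\<^sub>R x - shift 1 x - shift (- 1) x"
  by (simp add: neg_laplacian_op_def blinfun.diff_left blinfun.scaleR_left
      bounded_linear_Blinfun_apply bounded_linear_shift)

lemma seq_of_neg_laplacian_op: "seq_of (neg_laplacian_op x) n = - laplacian (seq_of x) n"
  by (simp add: neg_laplacian_op_apply laplacian_def)

section \<open>Kernels of exponentially decaying functions\<close>

text \<open>One geometric series runs to the right of i and one to the left. The centre is counted
  in both, which only enlarges the bound.\<close>

lemma sum_power_abs_le:
  fixes r :: real
  assumes "0 \<le> r" "r < 1" "finite F"
  shows "(\<Sum>j\<in>F. r ^ nat \<bar>j - i\<bar>) \<le> 2 / (1 - r)"
proof -
  obtain N :: nat where N: "\<And>j. j \<in> F \<Longrightarrow> nat \<bar>j - i\<bar> < N"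
  proof (rule that[of "Suc (\<Sum>j\<in>F. nat \<bar>j - i\<bar>)"])
    show "nat \<bar>j - i\<bar> < Suc (\<Sum>j\<in>F. nat \<bar>j - i\<bar>)" if "j \<in> F" for j
      using member_le_sum[OF that, of "\<lambda>j. nat \<bar>j - i\<bar>"] assms(3) by simp
  qed
  have geo: "(\<Sum>p<N. r ^ p) \<le> 1 / (1 - r)"
    using assms(1,2) by (simp add: sum_gp_strict divide_right_mono)
  have "F \<subseteq> (\<lambda>p. i + int p) ` {..<N} \<union> (\<lambda>p. i - int p) ` {..<N}"
  proof
    fix j assume "j \<in> F"
    show "j \<in> (\<lambda>p. i + int p) ` {..<N} \<union> (\<lambda>p. i - int p) ` {..<N}"
      using N[OF \<open>j \<in> F\<close>] by (cases "j \<ge> i") (auto intro: rev_image_eqI[where x = "nat \<bar>j - i\<bar>"])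
  qed
  hence "(\<Sum>j\<in>F. r ^ nat \<bar>j - i\<bar>) \<le>
      (\<Sum>j\<in>(\<lambda>p. i + int p) ` {..<N} \<union> (\<lambda>p. i - int p) ` {..<N}. r ^ nat \<bar>j - i\<bar>)"
    using assms(1) by (intro sum_mono2) auto
  also have "\<dots> \<le> (\<Sum>j\<in>(\<lambda>p. i + int p) ` {..<N}. r ^ nat \<bar>j - i\<bar>) +
      (\<Sum>j\<in>(\<lambda>p. i - int p) ` {..<N}. r ^ nat \<bar>j - i\<bar>)"
    using assms(1) sum.union_inter[of "(\<lambda>p. i + int p) ` {..<N}" "(\<lambda>p. i - int p) ` {..<N}"
        "\<lambda>j. r ^ nat \<bar>j - i\<bar>"]
      sum_nonneg[of "(\<lambda>p. i + int p) ` {..<N} \<inter> (\<lambda>p. i - int p) ` {..<N}" "\<lambda>j. r ^ nat \<bar>j - i\<bar>"]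
    by simp
  also have "\<dots> = (\<Sum>p<N. r ^ p) + (\<Sum>p<N. r ^ p)"
    by (subst (1 2) sum.reindex) (auto simp: inj_on_def)
  finally show ?thesis using geo by simp
qed

text \<open>With i the floor of x / a, the point x is within a of a * i, so |x - a * j| is at least
  a * |j - i| - a. The offset costs the factor exp (c * a), and a two-sided geometric series of
  ratio exp (- c * a) remains. The result does not depend on x.\<close>

definition exp_sum_bound :: "real \<Rightarrow> real \<Rightarrow> real" where
  "exp_sum_bound c a = exp (c * a) * (2 / (1 - exp (- (c * a))))"

lemma sum_exp_le:
  assumes "c > 0" "a > 0" "finite F"
  shows "(\<Sum>j\<in>F. exp (- c * \<bar>x - a * of_int j\<bar>)) \<le> exp_sum_bound c a"
proof -
  define i where "i = \<lfloor>x / a\<rfloor>"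
  have i: "\<bar>x - a * of_int i\<bar> \<le> a"
  proof -
    have "of_int i \<le> x / a" "x / a < of_int i + 1" by (simp_all add: i_def floor_less_cancel)
    hence "a * of_int i \<le> x" "x \<le> a * of_int i + a" using assms(2) by (simp_all add: field_simps)
    thus ?thesis by linarith
  qed
  have bnd: "exp (- c * \<bar>x - a * of_int j\<bar>) \<le> exp (c * a) * exp (- (c * a)) ^ nat \<bar>j - i\<bar>" for j
  proof -
    have "a * \<bar>of_int (j - i)\<bar> = \<bar>(x - a * of_int i) - (x - a * of_int j)\<bar>"
    proof -
      have "a * \<bar>of_int (j - i)\<bar> = \<bar>a * of_int (j - i)\<bar>" using assms(2) by (simp add: abs_mult)
      thus ?thesis by (simp add: right_diff_distrib)
    qed
    hence "a * \<bar>of_int (j - i)\<bar> \<le> a + \<bar>x - a * of_int j\<bar>" using i by linarith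
    hence "c * (a * \<bar>of_int (j - i)\<bar>) \<le> c * (a + \<bar>x - a * of_int j\<bar>)"
      using assms(1) by (intro mult_left_mono) auto
    hence "exp (- c * \<bar>x - a * of_int j\<bar>) \<le> exp (c * a + real (nat \<bar>j - i\<bar>) * (- (c * a)))"
      by (simp add: algebra_simps)
    thus ?thesis by (simp only: exp_add exp_of_nat_mult)
  qed
  have "(\<Sum>j\<in>F. exp (- c * \<bar>x - a * of_int j\<bar>)) \<le>
      exp (c * a) * (\<Sum>j\<in>F. exp (- (c * a)) ^ nat \<bar>j - i\<bar>)"
    unfolding sum_distrib_left by (rule sum_mono) (rule bnd)
  also have "\<dots> \<le> exp_sum_bound c a"
    unfolding exp_sum_bound_def using assms
    by (intro mult_left_mono sum_power_abs_le) auto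
  finally show ?thesis .
qed

lemma exp_sum_bound_nonneg: "c > 0 \<Longrightarrow> a > 0 \<Longrightarrow> 0 \<le> exp_sum_bound c a"
  using sum_exp_le[of c a "{}"] by simp

text \<open>The first index runs over the integer chain, the second over the chain of spacing a
  translated by b. The profile f is left free because the difference of two couplings at different b
  is again a coupling, of a difference of translates.\<close>

definition coupling :: "real \<Rightarrow> (real \<Rightarrow> real) \<Rightarrow> real \<Rightarrow> int \<Rightarrow> int \<Rightarrow> real" where
  "coupling a f b n m = f (of_int n - a * of_int m - b)"

text \<open>A row samples f along a lattice of spacing a, a column along one of spacing 1. The sum
  of the two bounds dominates each, and it is uniform in b.\<close>

lemma schur_coupling:
  assumes f: "\<And>x. \<bar>f x\<bar> \<le> C * exp (- c * \<bar>x\<bar>)" and "c > 0" "a > 0"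
  shows "schur (coupling a f b) (C * (exp_sum_bound c a + exp_sum_bound c 1))"
proof -
  have "C \<ge> 0" using f[of 0] by simp
  note pos = mult_nonneg_nonneg[OF this exp_sum_bound_nonneg]
  have "(\<Sum>m\<in>F. \<bar>coupling a f b n m\<bar>) \<le> C * exp_sum_bound c a" if "finite F" for n F
  proof -
    have "(\<Sum>m\<in>F. \<bar>coupling a f b n m\<bar>) \<le> C * (\<Sum>m\<in>F. exp (- c * \<bar>(of_int n - b) - a * of_int m\<bar>))"
      unfolding sum_distrib_left
      by (rule sum_mono) (use f in \<open>simp add: coupling_def algebra_simps\<close>)
    also have "\<dots> \<le> C * exp_sum_bound c a"
      by (intro mult_left_mono sum_exp_le assms that \<open>C \<ge> 0\<close>)
    finally show ?thesis .
  qed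
  moreover have "(\<Sum>n\<in>F. \<bar>coupling a f b n m\<bar>) \<le> C * exp_sum_bound c 1" if "finite F" for m F
  proof -
    have "(\<Sum>n\<in>F. \<bar>coupling a f b n m\<bar>) \<le> C * (\<Sum>n\<in>F. exp (- c * \<bar>(a * of_int m + b) - 1 * of_int n\<bar>))"
      unfolding sum_distrib_left
    proof (rule sum_mono)
      fix n
      have "\<bar>of_int n - a * of_int m - b\<bar> = \<bar>(a * of_int m + b) - 1 * of_int n\<bar>" by linarith
      thus "\<bar>coupling a f b n m\<bar> \<le> C * exp (- c * \<bar>(a * of_int m + b) - 1 * of_int n\<bar>)"
        using f[of "of_int n - a * of_int m - b"] by (simp only: coupling_def)
    qed
    also have "\<dots> \<le> C * exp_sum_bound c 1"
      by (intro mult_left_mono sum_exp_le assms that \<open>C \<ge> 0\<close>) auto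
    finally show ?thesis .
  qed
  ultimately show ?thesis
    using pos[of c a] pos[of c 1] assms(2,3) unfolding schur_def
    by (auto simp: distrib_left intro: add_increasing add_increasing2)
qed

lemma uniformly_continuous_exp_decay:
  fixes f :: "real \<Rightarrow> real"
  assumes cont: "continuous_on UNIV f"
    and f: "\<And>x. \<bar>f x\<bar> \<le> C * exp (- c * \<bar>x\<bar>)" and "c > 0"
  shows "uniformly_continuous_on UNIV f"
  unfolding uniformly_continuous_on_def
proof (intro allI impI)
  fix e :: real assume "e > 0"
  have "((\<lambda>r. C * exp (- c * r)) \<longlongrightarrow> C * 0) at_top"
    by (intro tendsto_mult tendsto_const filterlim_compose[OF exp_at_bot]
          filterlim_tendsto_neg_mult_at_bot[OF tendsto_const] filterlim_ident)
       (use \<open>c > 0\<close> in auto)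
  hence "\<forall>\<^sub>F r in at_top. C * exp (- c * r) < e / 2"
    using \<open>e > 0\<close> by (intro order_tendstoD(2)) auto
  then obtain R where R: "\<And>r. r \<ge> R \<Longrightarrow> C * exp (- c * r) < e / 2"
    by (auto simp: eventually_at_top_linorder)
  \<comment> \<open>The margin 1 matches the later choice \<open>min d 1\<close>: if one of two such
    close points has modulus below R, both lie in this interval. Otherwise both values are below e /
    2.\<close>
  have "uniformly_continuous_on {- \<bar>R\<bar> - 1..\<bar>R\<bar> + 1} f"
    by (intro compact_uniformly_continuous continuous_on_subset[OF cont]) auto
  then obtain d where d: "d > 0"
    "\<And>x y. \<lbrakk>x \<in> {- \<bar>R\<bar> - 1..\<bar>R\<bar> + 1}; y \<in> {- \<bar>R\<bar> - 1..\<bar>R\<bar> + 1}; dist y x < d\<rbrakk> \<Longrightarrow> dist (f y) (f x) < e"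
    using \<open>e > 0\<close> unfolding uniformly_continuous_on_def by metis
  show "\<exists>d>0. \<forall>x\<in>UNIV. \<forall>y\<in>UNIV. dist y x < d \<longrightarrow> dist (f y) (f x) < e"
  proof (intro exI[of _ "min d 1"] conjI ballI impI)
    fix x y :: real assume xy: "dist y x < min d 1"
    show "dist (f y) (f x) < e"
    proof (cases "\<bar>x\<bar> \<ge> R \<and> \<bar>y\<bar> \<ge> R")
      case True
      thus ?thesis using f[of x] f[of y] R[of "\<bar>x\<bar>"] R[of "\<bar>y\<bar>"] by (simp add: dist_real_def)
    next
      case False
      thus ?thesis using xy by (intro d(2)) (auto simp: dist_real_def)
    qed
  qed (use d in auto)
qed

text \<open>
  The decay is kept by taking half of it: \<open>\<bar>g\<bar>\<^sup>2 = \<bar>g\<bar> \<cdot> \<bar>g\<bar>\<close>, where one factor is small by uniform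
  continuity of \<open>f\<close> and the other one decays exponentially.
\<close>

lemma coupling_difference_small:
  fixes f :: "real \<Rightarrow> real"
  assumes cont: "continuous_on UNIV f"
    and f: "\<And>x. \<bar>f x\<bar> \<le> C * exp (- c * \<bar>x\<bar>)" and c: "c > 0" and a: "a > 0" and e: "e > 0"
  shows "\<exists>d>0. \<forall>b'. \<bar>b' - b\<bar> < d \<longrightarrow>
           schur (\<lambda>n m. coupling a f b' n m - coupling a f b n m) e"
proof -
  \<comment> \<open>For |b' - b| < 1 the difference g is at most C * (1 + exp c) * exp (- c * |x|).
    Its geometric mean with the bound s squared has constant s * \<open>C'\<close> and rate c / 2,
    and K is the resulting Schur constant without the factor s. Dividing e by K + 1 keeps s positive
    even for K = 0.\<close>
  define C' where "C' = sqrt (C * (1 + exp c))"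
  define K where "K = C' * (exp_sum_bound (c / 2) a + exp_sum_bound (c / 2) 1)"
  define s where "s = e / (K + 1)"
  have C: "0 \<le> C" using f[of 0] by simp
  have "0 \<le> K" using C c a by (simp add: K_def C'_def exp_sum_bound_nonneg)
  hence s: "s > 0" "s * K \<le> e" using e by (auto simp: s_def field_simps)
  obtain d where d: "d > 0" "\<And>x y. \<bar>y - x\<bar> < d \<Longrightarrow> \<bar>f y - f x\<bar> < s\<^sup>2"
    using uniformly_continuous_exp_decay[OF cont f c] zero_less_power[OF s(1), of 2]
    unfolding uniformly_continuous_on_def dist_real_def by (metis UNIV_I)
  have "schur (\<lambda>n m. coupling a f b' n m - coupling a f b n m) e" if b': "\<bar>b' - b\<bar> < min d 1" for b'
  proof -
    define g where "g x = f (x + (b - b')) - f x" for x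
    have g: "\<bar>g x\<bar> \<le> s * C' * exp (- (c / 2) * \<bar>x\<bar>)" for x
    proof (rule power2_le_imp_le)
      have "\<bar>g x\<bar> \<le> \<bar>f (x + (b - b'))\<bar> + \<bar>f x\<bar>" by (simp add: g_def)
      also have "\<dots> \<le> C * exp (- c * \<bar>x + (b - b')\<bar>) + C * exp (- c * \<bar>x\<bar>)"
        by (intro add_mono f)
      also have "exp (- c * \<bar>x + (b - b')\<bar>) \<le> exp (c * 1 - c * \<bar>x\<bar>)"
      proof -
        have "\<bar>x\<bar> - 1 \<le> \<bar>x + (b - b')\<bar>" using b' by linarith
        hence "c * (\<bar>x\<bar> - 1) \<le> c * \<bar>x + (b - b')\<bar>" using c by (intro mult_left_mono) auto
        thus ?thesis by (simp add: algebra_simps)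
      qed
      also have "C * exp (c * 1 - c * \<bar>x\<bar>) + C * exp (- c * \<bar>x\<bar>) = C * (1 + exp c) * exp (- c * \<bar>x\<bar>)"
        by (simp add: exp_diff exp_minus field_simps)
      finally have 1: "\<bar>g x\<bar> \<le> C * (1 + exp c) * exp (- c * \<bar>x\<bar>)"
        using C by (simp add: mult_left_mono)
      have 2: "\<bar>g x\<bar> \<le> s\<^sup>2" using d(2)[of "x + (b - b')" x] b' by (simp add: g_def abs_minus_commute less_imp_le)
      have "\<bar>g x\<bar>\<^sup>2 = \<bar>g x\<bar> * \<bar>g x\<bar>" by (simp add: power2_eq_square)
      also have "\<dots> \<le> s\<^sup>2 * (C * (1 + exp c) * exp (- c * \<bar>x\<bar>))"
        by (intro mult_mono 1 2) auto
      also have "\<dots> = (s * C' * exp (- (c / 2) * \<bar>x\<bar>))\<^sup>2"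
        using C by (simp add: C'_def power_mult_distrib add_nonneg_nonneg flip: exp_double)
      finally show "\<bar>g x\<bar>\<^sup>2 \<le> (s * C' * exp (- (c / 2) * \<bar>x\<bar>))\<^sup>2" .
    qed (use s C in \<open>auto simp: C'_def\<close>)
    have "(\<lambda>n m. coupling a f b' n m - coupling a f b n m) = coupling a g b"
      by (simp add: fun_eq_iff coupling_def g_def algebra_simps)
    moreover have "schur (coupling a g b) (s * K)"
      using schur_coupling[OF g, of a b] c a by (simp add: K_def mult.assoc)
    ultimately show ?thesis using s(2) by (auto intro: schur_mono)
  qed
  thus ?thesis using d(1) by (intro exI[of _ "min d 1"]) auto
qed

lemma continuous_coupling_op:
  fixes f :: "real \<Rightarrow> real"
  assumes cont: "continuous_on UNIV f"
    and f: "\<And>x. \<bar>f x\<bar> \<le> C * exp (- c * \<bar>x\<bar>)" and c: "c > 0" and a: "a > 0"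
  shows "continuous_on UNIV (\<lambda>b. kernel_op (coupling a f b))"
    and "continuous_on UNIV (\<lambda>b. kernel_op (\<lambda>n m. coupling a f b m n))"
proof -
  note S = schur_coupling[OF f c a]
  have *: "\<exists>d>0. \<forall>b'. dist b' b < d \<longrightarrow>
          dist (kernel_op (coupling a f b')) (kernel_op (coupling a f b)) < e \<and>
          dist (kernel_op (\<lambda>n m. coupling a f b' m n)) (kernel_op (\<lambda>n m. coupling a f b m n)) < e"
    if e: "e > 0" for b e
  proof -
    obtain d where d: "d > 0" "\<And>b'. \<bar>b' - b\<bar> < d \<Longrightarrow>
           schur (\<lambda>n m. coupling a f b' n m - coupling a f b n m) (e / 2)"
      using coupling_difference_small[OF cont f c a, of "e / 2" b] e by auto
    have "norm (kernel_op (coupling a f b') - kernel_op (coupling a f b)) < e \<and>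
          norm (kernel_op (\<lambda>n m. coupling a f b' m n) - kernel_op (\<lambda>n m. coupling a f b m n)) < e"
      if "\<bar>b' - b\<bar> < d" for b'
      using norm_kernel_op[OF d(2)[OF that]] norm_kernel_op[OF schur_transpose[OF d(2)[OF that]]] e
      by (simp add: kernel_op_diff[OF S S] kernel_op_diff[OF schur_transpose[OF S] schur_transpose[OF S]])
    thus ?thesis using d(1) by (auto simp: dist_norm)
  qed
  thus "continuous_on UNIV (\<lambda>b. kernel_op (coupling a f b))"
    and "continuous_on UNIV (\<lambda>b. kernel_op (\<lambda>n m. coupling a f b m n))"
    unfolding continuous_on_iff by (meson UNIV_I)+
qed

section \<open>The Green function\<close>

text \<open>The powers of l solve the recurrence of -\<Delta> - \<mu> with \<kappa> = 2 - \<mu>. For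
  |\<kappa>| > 2 the polynomial p is 1 at 0 and negative at 1, so a root lies strictly between; the
  sign of \<kappa> is restored afterwards.\<close>

lemma characteristic_root:
  fixes \<kappa> :: real
  assumes "\<bar>\<kappa>\<bar> > 2"
  obtains l where "\<bar>l\<bar> < 1" "l\<^sup>2 + 1 = \<kappa> * l"
proof -
  define p where "p r = r\<^sup>2 - \<bar>\<kappa>\<bar> * r + 1" for r
  have "\<exists>r\<ge>0. r \<le> 1 \<and> p r = 0"
    by (rule IVT2) (use assms in \<open>auto simp: p_def intro!: continuous_intros\<close>)
  then obtain r where r: "0 \<le> r" "r \<le> 1" "p r = 0" by blast
  have "r \<noteq> 1" using r(3) assms by (auto simp: p_def)
  show ?thesis
  proof (rule that[of "sgn \<kappa> * r"])
    show "\<bar>sgn \<kappa> * r\<bar> < 1" using r \<open>r \<noteq> 1\<close> assms by (auto simp: abs_mult sgn_if)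
    show "(sgn \<kappa> * r)\<^sup>2 + 1 = \<kappa> * (sgn \<kappa> * r)"
      using r(3) assms by (auto simp: p_def sgn_if power_mult_distrib)
  qed
qed

text \<open>A difference d of two preimages satisfies \<kappa> d(n) = d(n+1) + d(n-1), so any
  uniform bound on it improves by the factor 2 / |\<kappa>| < 1. Iteration forces d = 0. Injectivity
  is what allows \<open>inv_into\<close> to be evaluated at an explicit preimage.\<close>

lemma neg_laplacian_minus_scalar_inj:
  assumes "\<mu> \<notin> {0..4}"
  shows "inj_on (minus_scalar (\<lambda>\<psi> n. - laplacian \<psi> n) (complex_of_real \<mu>)) ell2"
proof (rule inj_onI)
  fix \<phi> \<psi>
  assume in_ell2: "\<phi> \<in> ell2" "\<psi> \<in> ell2"
    and eq: "minus_scalar (\<lambda>\<psi> n. - laplacian \<psi> n) (complex_of_real \<mu>) \<phi> =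
        minus_scalar (\<lambda>\<psi> n. - laplacian \<psi> n) (complex_of_real \<mu>) \<psi>"
  define x where "x = l2_of \<phi> - l2_of \<psi>"
  define d where "d = seq_of x"
  have d: "d n = \<phi> n - \<psi> n" for n using in_ell2 by (simp add: d_def x_def l2_of_inverse)
  define \<kappa> where "\<kappa> = 2 - \<mu>"
  have \<kappa>: "\<bar>\<kappa>\<bar> > 2" using assms by (auto simp: \<kappa>_def)
  have rec: "complex_of_real \<kappa> * d n = d (n + 1) + d (n - 1)" for n
    using fun_cong[OF eq, of n] by (simp add: minus_scalar_def laplacian_def d \<kappa>_def algebra_simps)
  have bound: "cmod (d n) \<le> (2 / \<bar>\<kappa>\<bar>) ^ p * norm x" for n p
  proof (induction p arbitrary: n)
    case 0
    show ?case by (simp add: d_def cmod_seq_of_le)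
  next
    case (Suc p)
    have "\<bar>\<kappa>\<bar> * cmod (d n) = cmod (d (n + 1) + d (n - 1))"
      using arg_cong[OF rec[of n], of cmod] by (simp add: norm_mult)
    also have "\<dots> \<le> cmod (d (n + 1)) + cmod (d (n - 1))" by (rule norm_triangle_ineq)
    also have "\<dots> \<le> 2 * ((2 / \<bar>\<kappa>\<bar>) ^ p * norm x)" using Suc[of "n + 1"] Suc[of "n - 1"] by linarith
    finally have "cmod (d n) \<le> 2 * ((2 / \<bar>\<kappa>\<bar>) ^ p * norm x) / \<bar>\<kappa>\<bar>"
      using \<kappa> by (simp add: pos_le_divide_eq mult.commute)
    thus ?case by simp
  qed
  have "d n = 0" for n
  proof -
    have "(\<lambda>p. (2 / \<bar>\<kappa>\<bar>) ^ p * norm x) \<longlonglongrightarrow> 0 * norm x"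
      using \<kappa> by (intro tendsto_mult tendsto_const LIMSEQ_power_zero) auto
    from LIMSEQ_le_const[OF this, of "cmod (d n)"] bound[of n] show ?thesis by auto
  qed
  thus "\<phi> = \<psi>" using d by auto
qed

lemma green_eq:
  assumes "\<mu> \<notin> {0..4}"
  obtains g l :: real where "\<bar>l\<bar> < 1" "\<And>n m. green \<mu> n m = complex_of_real (g * l ^ nat \<bar>n - m\<bar>)"
proof -
  define \<kappa> where "\<kappa> = 2 - \<mu>"
  have "\<bar>\<kappa>\<bar> > 2" using assms by (auto simp: \<kappa>_def)
  then obtain l where l: "\<bar>l\<bar> < 1" "l\<^sup>2 + 1 = \<kappa> * l" by (rule characteristic_root)
  have "l\<^sup>2 < 1" using l(1) by (simp add: abs_square_less_1)
  \<comment> \<open>If \<kappa> were 2 * l, the quadratic equation would give l squared equal to 1.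
    The number \<kappa> - 2 * l is the defect of the recurrence at the diagonal, so its inverse g
    normalises the solution to a unit point source.\<close>
  hence nz: "\<kappa> - 2 * l \<noteq> 0" using l(2) by (auto simp: power2_eq_square)
  define g where "g = 1 / (\<kappa> - 2 * l)"
  define u :: "int \<Rightarrow> int \<Rightarrow> complex" where "u m n = complex_of_real (g * l ^ nat \<bar>n - m\<bar>)" for m n
  have u_ell2: "u m \<in> ell2" for m
  proof (rule ell2_boundI(1))
    fix F :: "int set" assume F: "finite F"
    have "(\<Sum>n\<in>F. (cmod (u m n))\<^sup>2) = g\<^sup>2 * (\<Sum>n\<in>F. (l\<^sup>2) ^ nat \<bar>n - m\<bar>)"
      unfolding sum_distrib_left
      by (simp only: u_def norm_of_real power2_abs power_mult_distrib power_mult[symmetric] mult.commute[of 2])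
    also have "\<dots> \<le> g\<^sup>2 * (2 / (1 - l\<^sup>2))"
      by (intro mult_left_mono sum_power_abs_le) (use F \<open>l\<^sup>2 < 1\<close> in auto)
    finally show "(\<Sum>n\<in>F. (cmod (u m n))\<^sup>2) \<le> g\<^sup>2 * (2 / (1 - l\<^sup>2))" .
  qed
  have "- laplacian (u m) n - complex_of_real \<mu> * u m n = (if n = m then 1 else 0)" for m n
  proof -
    have "\<kappa> * l ^ nat \<bar>j\<bar> - l ^ nat \<bar>j + 1\<bar> - l ^ nat \<bar>j - 1\<bar> = (if j = 0 then \<kappa> - 2 * l else 0)" for j :: int
    proof (cases "j = 0")
      case False
      \<comment> \<open>Off the diagonal the two neighbours lie at distances p and p + 2 in some
        order, and the recurrence is the quadratic equation times l to the power p.\<close>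
      define p where "p = nat \<bar>j\<bar> - 1"
      have "nat \<bar>j\<bar> = Suc p" using False by (simp add: p_def)
      moreover have "(nat \<bar>j + 1\<bar> = Suc (Suc p) \<and> nat \<bar>j - 1\<bar> = p) \<or>
          (nat \<bar>j + 1\<bar> = p \<and> nat \<bar>j - 1\<bar> = Suc (Suc p))"
        using False unfolding p_def by arith
      hence "l ^ nat \<bar>j + 1\<bar> + l ^ nat \<bar>j - 1\<bar> = l ^ Suc (Suc p) + l ^ p"
        by (elim disjE conjE) (simp_all only: add.commute)
      moreover have "\<kappa> * l ^ Suc p = l ^ Suc (Suc p) + l ^ p"
        using arg_cong[OF l(2), of "\<lambda>r. r * l ^ p"] by (simp add: power2_eq_square algebra_simps)
      ultimately show ?thesis using False by simp
    qed auto
    from arg_cong[OF this[of "n - m"], of "\<lambda>r. complex_of_real (g * r)"]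
    have "complex_of_real \<kappa> * u m n - u m (n + 1) - u m (n - 1) =
        complex_of_real (if n = m then g * (\<kappa> - 2 * l) else 0)"
      by (simp add: u_def algebra_simps split: if_splits)
    also have "g * (\<kappa> - 2 * l) = 1" using nz by (simp add: g_def)
    finally show ?thesis by (simp add: laplacian_def \<kappa>_def algebra_simps split: if_splits)
  qed
  hence "minus_scalar (\<lambda>\<psi> n. - laplacian \<psi> n) (complex_of_real \<mu>) (u m) = (\<lambda>n. if n = m then 1 else 0)" for m
    by (auto simp: minus_scalar_def)
  hence "green \<mu> n m = u m n" for n m
    unfolding green_def matrix_element_def resolvent_def
    using inv_into_f_eq[OF neg_laplacian_minus_scalar_inj[OF assms] u_ell2] by metis
  thus ?thesis using that[OF l(1), of g] by (simp add: u_def)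
qed

lemma schur_geometric:
  assumes "\<bar>l\<bar> < 1"
  shows "schur (\<lambda>n m. g * l ^ nat \<bar>n - m\<bar>) (\<bar>g\<bar> * (2 / (1 - \<bar>l\<bar>)))"
proof -
  have 1: "(\<Sum>m\<in>F. \<bar>g * l ^ nat \<bar>m - n\<bar>\<bar>) \<le> \<bar>g\<bar> * (2 / (1 - \<bar>l\<bar>))" if "finite F" for n F
    unfolding abs_mult power_abs sum_distrib_left[symmetric]
    by (intro mult_left_mono sum_power_abs_le) (use assms that in auto)
  have 2: "(\<Sum>m\<in>F. \<bar>g * l ^ nat \<bar>n - m\<bar>\<bar>) \<le> \<bar>g\<bar> * (2 / (1 - \<bar>l\<bar>))" if "finite F" for n F
    using 1[OF that, of n] by (simp only: abs_minus_commute[of n])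
  show ?thesis unfolding schur_def using 1 2 by blast
qed

section \<open>Dense translations and the two symmetries in b\<close>

lemma dense_int_combinations:
  fixes a :: real
  assumes "a \<notin> \<rat>" "open U" "u \<in> U"
  obtains j k :: int where "b + of_int j + of_int k * a \<in> U"
proof -
  obtain e where e: "e > 0" "\<And>y. dist y u < e \<Longrightarrow> y \<in> U"
    using assms(2,3) by (auto simp: open_dist)
  \<comment> \<open>Kronecker's approximation theorem with target u - b; the integer h enters the
    orbit with opposite sign.\<close>
  obtain h k where "\<bar>of_int k * a - of_int h - (u - b)\<bar> < e"
    using sequence_of_fractional_parts_is_dense[OF assms(1) e(1)] by metis
  hence "dist (b + of_int (- h) + of_int k * a) u < e" by (simp add: dist_real_def algebra_simps)
  thus ?thesis using e(2) that by blast
qed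

lemma int_translation_invariant:
  fixes P :: "real \<Rightarrow> bool"
  assumes "\<And>b. P (b + a) \<longleftrightarrow> P b"
  shows "P (b + of_int k * a) \<longleftrightarrow> P b"
proof -
  have nat: "P (b + of_nat n * a) \<longleftrightarrow> P b" for n b
    by (induction n) (use assms[of "b + of_nat _ * a"] in \<open>auto simp: algebra_simps\<close>)
  show ?thesis
  proof (cases "k \<ge> 0")
    case True
    thus ?thesis using nat[of b "nat k"] by simp
  next
    case False
    thus ?thesis using nat[of "b + of_int k * a" "nat (- k)"] by (simp add: algebra_simps)
  qed
qed

lemma infsum_shift_int:
  fixes f :: "int \<Rightarrow> 'b::{topological_comm_monoid_add, t2_space}"
  shows "(\<Sum>\<^sub>\<infinity>n. f (n + j)) = (\<Sum>\<^sub>\<infinity>n. f n)"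
  by (rule infsum_reindex_bij_betw[OF bij_plus_right])

text \<open>Reindexing by a bijection is valid for infinite sums without summability, so the two
  operators agree on every sequence and their spectra coincide without any conjugation. The index
  shift is carried outwards from the innermost sum through the Green function.\<close>

lemma reduced_chain_op_period:
  assumes "\<And>n m j. green \<mu> (n + j) (m + j) = green \<mu> n m"
  shows "reduced_chain_op \<mu> h \<theta> (b + (1 - \<theta>)) = reduced_chain_op \<mu> h \<theta> b"
proof (intro ext)
  fix \<psi> n
  define w where "w c m = (\<Sum>\<^sub>\<infinity>n'''. complex_of_real (h ((1 - \<theta>) * of_int m + c - of_int n''')) * \<psi> n''')" for c m
  define v where "v c m = (\<Sum>\<^sub>\<infinity>n''. green \<mu> m n'' * w c n'')" for c m
  have w: "w (b + (1 - \<theta>)) m = w b (m + 1)" for m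
    by (simp add: w_def algebra_simps)
  have v: "v (b + (1 - \<theta>)) m = v b (m + 1)" for m
    unfolding v_def using infsum_shift_int[of "\<lambda>n''. green \<mu> (m + 1) n'' * w b n''" 1]
    by (simp add: w assms)
  have "(\<Sum>\<^sub>\<infinity>n'. complex_of_real (h (of_int n - (1 - \<theta>) * of_int n' - (b + (1 - \<theta>)))) * v (b + (1 - \<theta>)) n') =
     (\<Sum>\<^sub>\<infinity>n'. complex_of_real (h (of_int n - (1 - \<theta>) * of_int n' - b)) * v b n')"
    using infsum_shift_int[of "\<lambda>n'. complex_of_real (h (of_int n - (1 - \<theta>) * of_int n' - b)) * v b n'" 1]
    by (simp only: v) (simp add: algebra_simps)
  thus "reduced_chain_op \<mu> h \<theta> (b + (1 - \<theta>)) \<psi> n = reduced_chain_op \<mu> h \<theta> b \<psi> n"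
    by (simp add: reduced_chain_op_def v_def w_def)
qed

lemma reduced_chain_op_covariant:
  "reduced_chain_op \<mu> h \<theta> (b + 1) (\<lambda>n. \<psi> (n - 1)) n = reduced_chain_op \<mu> h \<theta> b \<psi> (n - 1)"
proof -
  have "(\<Sum>\<^sub>\<infinity>n'''. complex_of_real (h ((1 - \<theta>) * of_int m + (b + 1) - of_int n''')) * \<psi> (n''' - 1)) =
      (\<Sum>\<^sub>\<infinity>n'''. complex_of_real (h ((1 - \<theta>) * of_int m + b - of_int n''')) * \<psi> n''')" for m
    using infsum_shift_int[of "\<lambda>n'''. complex_of_real (h ((1 - \<theta>) * of_int m + b - of_int n''')) * \<psi> n'''" "- 1"]
    by (simp add: algebra_simps)
  moreover have "h (of_int n - (1 - \<theta>) * of_int n' - (b + 1)) = h (of_int (n - 1) - (1 - \<theta>) * of_int n' - b)" for n'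
    by (simp add: algebra_simps)
  ultimately show ?thesis by (simp add: reduced_chain_op_def laplacian_def)
qed

section \<open>The reduced chain operator\<close>

lemma inner_neg_laplacian_op: "neg_laplacian_op x \<bullet> y = x \<bullet> neg_laplacian_op y"
  by (simp add: neg_laplacian_op_apply inner_diff_left inner_diff_right inner_shift)

lemma kernel_op_cmul: "schur k M \<Longrightarrow> kernel_op k (cmul c x) = cmul c (kernel_op k x)"
  by (rule l2_eqI) (simp add: seq_of_kernel_op kernel_apply_def mult.left_commute infsum_cmult_right')

lemma neg_laplacian_op_cmul: "neg_laplacian_op (cmul c x) = cmul c (neg_laplacian_op x)"
  by (rule l2_eqI) (simp add: seq_of_neg_laplacian_op laplacian_def algebra_simps)

text \<open>The operator factors as the negative Laplacian minus T G T^t. Symmetry follows because G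
  is symmetric and the outer factors are mutual transposes; continuity follows from that of T and
  T^t, since composition of bounded operators is a bounded bilinear map.\<close>

lemma reduced_chain_op_bounded_symmetric:
  assumes \<mu>: "\<mu> \<notin> {0..4}" and even: "\<And>x. h (- x) = h x" and cont: "continuous_on UNIV h"
    and h: "\<And>x. \<bar>h x\<bar> \<le> C * exp (- c * \<bar>x\<bar>)" and "c > 0" "\<theta> < 1"
  obtains H where
    "\<And>b x. seq_of (blinfun_apply (H b) x) = reduced_chain_op \<mu> h \<theta> b (seq_of x)"
    "continuous_on UNIV H"
    "\<And>b x y. blinfun_apply (H b) x \<bullet> y = x \<bullet> blinfun_apply (H b) y"
    "\<And>b c x. blinfun_apply (H b) (cmul c x) = cmul c (blinfun_apply (H b) x)"
proof -
  obtain g l where "\<bar>l\<bar> < 1" and green: "\<And>n m. green \<mu> n m = complex_of_real (g * l ^ nat \<bar>n - m\<bar>)"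
    using green_eq[OF \<mu>] by metis
  define G where "G n m = g * l ^ nat \<bar>n - m\<bar>" for n m :: int
  obtain N where G: "schur G N"
    using schur_geometric[OF \<open>\<bar>l\<bar> < 1\<close>, of g] unfolding G_def by blast
  define T where "T b = coupling (1 - \<theta>) h b" for b
  obtain M where T: "\<And>b. schur (T b) M"
    using schur_coupling[OF h \<open>c > 0\<close>, of "1 - \<theta>"] \<open>\<theta> < 1\<close> unfolding T_def by force
  note T' = schur_transpose[OF T]
  define H where "H b = neg_laplacian_op -
      (kernel_op (T b) o\<^sub>L kernel_op G o\<^sub>L kernel_op (\<lambda>n m. T b m n))" for b
  have H: "H b x = neg_laplacian_op x - kernel_op (T b) (kernel_op G (kernel_op (\<lambda>n m. T b m n) x))" for b x
    by (simp add: H_def blinfun.diff_left)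
  \<comment> \<open>Evenness of h enters here: it identifies the right-hand coupling with the
    transpose of the left-hand one.\<close>
  have flip: "T b m n = h ((1 - \<theta>) * of_int n + b - of_int m)" for b n m
    using even[of "(1 - \<theta>) * of_int n + b - of_int m"] by (simp add: T_def coupling_def algebra_simps)
  show ?thesis
  proof (rule that[of H])
    show "seq_of (H b x) = reduced_chain_op \<mu> h \<theta> b (seq_of x)" for b x
    proof
      fix n
      have "complex_of_real (T b n m) = complex_of_real (h (of_int n - (1 - \<theta>) * of_int m - b))" for m
        by (simp add: T_def coupling_def)
      thus "seq_of (H b x) n = reduced_chain_op \<mu> h \<theta> b (seq_of x) n"
        by (simp add: H seq_of_neg_laplacian_op reduced_chain_op_def seq_of_kernel_op[OF T]
            seq_of_kernel_op[OF T'] seq_of_kernel_op[OF G] kernel_apply_def green flip: flip G_def)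
    qed
    show "continuous_on UNIV H"
      unfolding H_def T_def using \<open>\<theta> < 1\<close>
      by (intro continuous_intros continuous_coupling_op[OF cont h \<open>c > 0\<close>]
            bounded_bilinear.continuous_on[OF bounded_bilinear_blinfun_compose]) auto
    show "H b x \<bullet> y = x \<bullet> H b y" for b x y
    proof -
      have "(\<lambda>n m. G m n) = G" by (simp add: G_def abs_minus_commute fun_eq_iff)
      thus ?thesis
        by (simp add: H inner_diff_left inner_diff_right inner_neg_laplacian_op
            inner_kernel_op_transpose[OF T] inner_kernel_op_transpose[OF T'] inner_kernel_op_transpose[OF G])
    qed
    show "H b (cmul c x) = cmul c (H b x)" for b c x
      by (simp add: H kernel_op_cmul[OF T] kernel_op_cmul[OF T'] kernel_op_cmul[OF G]
          neg_laplacian_op_cmul linear_diff[OF bounded_linear.linear[OF bounded_linear_cmul]])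
  qed
qed

proposition spectrum_reduced_chain_op:
  assumes \<mu>: "\<mu> \<notin> {0..4}" and even: "\<And>x. h (- x) = h x" and cont: "continuous_on UNIV h"
    and h: "exponentially_decaying h" and \<theta>: "\<theta> \<notin> \<rat>" "\<theta> < 1"
  shows "spectrum (reduced_chain_op \<mu> h \<theta> b) \<subseteq> \<real>"
    and "spectrum (reduced_chain_op \<mu> h \<theta> b) = spectrum (reduced_chain_op \<mu> h \<theta> b')"
proof -
  obtain C c where "c > 0" and C: "\<And>x. \<bar>h x\<bar> \<le> C * exp (- c * \<bar>x\<bar>)"
    using h by (auto simp: exponentially_decaying_def)
  obtain H where H: "\<And>b x. seq_of (blinfun_apply (H b) x) = reduced_chain_op \<mu> h \<theta> b (seq_of x)"
    and contH: "continuous_on UNIV H"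
    and sym: "\<And>b x y. blinfun_apply (H b) x \<bullet> y = x \<bullet> blinfun_apply (H b) y"
    and cmulH: "\<And>b c x. blinfun_apply (H b) (cmul c x) = cmul c (blinfun_apply (H b) x)"
    using reduced_chain_op_bounded_symmetric[OF \<mu> even cont C \<open>c > 0\<close> \<theta>(2)] by blast
  define P where "P z b \<longleftrightarrow> boundedly_invertible (H b - cmul_op z)" for z b
  have mem: "z \<in> spectrum (reduced_chain_op \<mu> h \<theta> b) \<longleftrightarrow> \<not> P z b" for z b
  proof -
    have "seq_of ((H b - cmul_op z) x) = minus_scalar (reduced_chain_op \<mu> h \<theta> b) z (seq_of x)" for x
      by (simp add: fun_eq_iff blinfun.diff_left H minus_scalar_def)
    from mem_resolvent_set_iff[OF this] show ?thesis by (simp add: spectrum_def P_def)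
  qed
  show "spectrum (reduced_chain_op \<mu> h \<theta> b) \<subseteq> \<real>"
  proof
    fix z assume "z \<in> spectrum (reduced_chain_op \<mu> h \<theta> b)"
    hence "Im z = 0"
      using symmetric_nonreal_boundedly_invertible[OF sym cmulH] by (auto simp: mem P_def)
    thus "z \<in> \<real>" by (simp add: complex_is_Real_iff)
  qed
  have open_P: "open {b. P z b}" for z
  proof -
    have "continuous_on UNIV (\<lambda>b. H b - cmul_op z)" by (intro continuous_intros contH)
    from open_vimage[OF open_boundedly_invertible this] show ?thesis by (simp add: vimage_def P_def)
  qed
  have P_\<theta>: "P z (b + (1 - \<theta>)) \<longleftrightarrow> P z b" for z b
  proof -
    have "green \<mu> (n + j) (m + j) = green \<mu> n m" for n m j
      by (rule green_eq[OF \<mu>]) simp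
    from reduced_chain_op_period[OF this] have "reduced_chain_op \<mu> h \<theta> (b + (1 - \<theta>)) = reduced_chain_op \<mu> h \<theta> b" .
    thus ?thesis using mem by metis
  qed
  have P_1: "P z (b + 1) \<longleftrightarrow> P z b" for z b
  proof -
    have comm: "(H (b + 1) - cmul_op z) (shift (- 1) x) = shift (- 1) ((H b - cmul_op z) x)" for x
    proof (rule l2_eqI)
      fix n
      have "seq_of (shift (- 1) x) = (\<lambda>n. seq_of x (n - 1))" by auto
      thus "seq_of ((H (b + 1) - cmul_op z) (shift (- 1) x)) n = seq_of (shift (- 1) ((H b - cmul_op z) x)) n"
        using reduced_chain_op_covariant[of \<mu> h \<theta> b "seq_of x" n]
        by (simp add: blinfun.diff_left H)
    qed
    \<comment> \<open>The opposite shift gives the reverse intertwining, so invertibility passes in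
      both directions.\<close>
    have "(H b - cmul_op z) (shift 1 y) = shift 1 ((H (b + 1) - cmul_op z) y)" for y
    proof -
      have inv: "shift 1 (shift (- 1) y) = y" "shift (- 1) (shift 1 y) = y" for y
        by (auto intro!: l2_eqI)
      show ?thesis using arg_cong[OF comm[of "shift 1 y"], of "shift 1"] by (simp only: inv)
    qed
    thus ?thesis
      unfolding P_def using boundedly_invertible_conj[OF _ bij_shift norm_shift] comm by blast
  qed
  \<comment> \<open>The orbit of b under the dense group meets the open set around b'. Invertibility
    at the orbit point is then carried back to b by the two invariances.\<close>
  have "P z b" if "P z b'" for z b b'
  proof -
    have "1 - \<theta> \<notin> \<rat>" using \<theta>(1) Rats_diff[OF Rats_1, of "1 - \<theta>"] by auto
    moreover have "b' \<in> {b. P z b}" using that by simp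
    ultimately obtain j k where "P z (b + of_int j + of_int k * (1 - \<theta>))"
      using dense_int_combinations[OF _ open_P[of z]] by (metis mem_Collect_eq)
    thus ?thesis
      using int_translation_invariant[of "P z", OF P_\<theta>] int_translation_invariant[of "P z" 1, OF P_1, of b j]
      by simp
  qed
  thus "spectrum (reduced_chain_op \<mu> h \<theta> b) = spectrum (reduced_chain_op \<mu> h \<theta> b')"
    using mem by blast
qed

theorem corollary3p9:
  fixes \<mu> :: real and h :: "real \<Rightarrow> real" and \<theta> :: real
  assumes "\<mu> \<notin> {0..4}"
    and "\<And>x. h (- x) = h x"
    and "smooth h"
    and "exponentially_decaying h"
    and "\<theta> \<notin> \<rat>"
    and "0 < \<theta>" and "\<theta> < 1"
  shows "\<exists>\<Sigma> :: real set.
    measure (uniform_measure lebesgue {0..<1 - \<theta>})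
      {b \<in> {0..<1 - \<theta>}. spectrum (reduced_chain_op \<mu> h \<theta> b) = complex_of_real ` \<Sigma>} = 1"
proof -
  have "h differentiable_on UNIV"
    using assms(3) unfolding smooth_def by (metis funpow_0)
  hence cont: "continuous_on UNIV h" by (rule differentiable_imp_continuous_on)
  note S = spectrum_reduced_chain_op[OF assms(1,2) cont assms(4,5,7)]
  \<comment> \<open>The value b = 0 serves as reference. Containment in the reals is what lets the
    complex spectrum be recovered as the image of a set of real numbers.\<close>
  obtain \<Sigma> :: "real set" where \<Sigma>: "\<And>b. spectrum (reduced_chain_op \<mu> h \<theta> b) = complex_of_real ` \<Sigma>"
  proof
    let ?\<Sigma> = "{r. complex_of_real r \<in> spectrum (reduced_chain_op \<mu> h \<theta> 0)}"
    show "spectrum (reduced_chain_op \<mu> h \<theta> b) = complex_of_real ` ?\<Sigma>" for b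
      unfolding S(2)[of b 0] using S(1)[of 0] by (auto elim!: Reals_cases)
  qed
  \<comment> \<open>Normalisation is legitimate because the interval has positive finite length.
    With \<Sigma> valid for every b, the event is the whole interval.\<close>
  have "measure (uniform_measure lebesgue {0..<1 - \<theta>}) {0..<1 - \<theta>} = 1"
    using assms(7) by (subst measure_uniform_measure) auto
  hence "measure (uniform_measure lebesgue {0..<1 - \<theta>})
      {b \<in> {0..<1 - \<theta>}. spectrum (reduced_chain_op \<mu> h \<theta> b) = complex_of_real ` \<Sigma>} = 1"
    by (simp only: \<Sigma> simp_thms Collect_mem_eq)
  thus ?thesis ..
qed

end
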